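(* Consider the $N\times N$ matrix Painlevé II system with parameters $\alpha_0+\alpha_1=1$. Put $f=p+q^2+\frac t2$. The transformations $$s_1:\quad q\mapsto q+\alpha_1f^{-1},\qquad p\mapsto p-\alpha_1(qf^{-1}+f^{-1}q)-\alpha_1^2f^{-2},\qquad t\mapsto t,\qquad (\alpha_0,\alpha_1)\mapsto(\alpha_0+2\alpha_1,-\alpha_1),$$ $$r:\quad q\mapsto-q,\qquad p\mapsto-p,\qquad t\mapsto t,\qquad(\alpha_0,\alpha_1)\mapsto(\alpha_1,\alpha_0)$$ are Bäcklund transformations of matrix Painlevé II. They generate a group isomorphic to $C_2\ltimes W(A_1^{(1)})$, where $W(A_1^{(1)})$ is the affine Weyl group generated by the simple reflections $s_0=rs_1r^{-1}$ and $s_1$, and $C_2=\{e,r\}$ acts by exchanging $s_0$ and $s_1$.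
   Context: The $N\times N$ matrix Painlevé II system has phase space $\mathrm{Mat}_N(\mathbb C)\times\mathrm{Mat}_N(\mathbb C)\ni(p,q)$ with symplectic form $\omega=\mathrm{Tr}(\mathrm dp\wedge\mathrm dq)$, time $t\in\mathbb C$, a scalar parameter $\theta$ with $\alpha_1=\theta+\frac12$, $\alpha_0=1-\alpha_1$, and Hamiltonian $$H_\theta(p,q;t)=\mathrm{Tr}\Big(\frac{p^2}2-\frac12\Big(q^2+\frac t2\Big)^2-\theta q\Big),$$ i.e. equations of motion $\dot q=p$, $\dot p=2q^3+tq+\theta$. For a system of ordinary differential equations $\mathbb D(\alpha)$ depending on parameters $\alpha\in\mathbb C^k$ with extended phase space $M$ (including time), a pair of maps $(\pi,\tilde\pi)$ on $M\times\mathbb C^k$ ($\pi$ acts on $M$, possibly depending on $\alpha$ and possibly only rational, $\tilde\pi$ acts on parameters) is a Bäcklund transformation if $\pi$ maps solutions of $\mathbb D(\alpha)$ to solutions of $\mathbb D(\tilde\pi(\alpha))$. The group generated is the group of (birational) transformations of the variables $(p,q,t)$ together with the parameters. $W(A_1^{(1)})$ is the Coxeter group generated by two involutions $s_0,s_1$ with no further relations. *)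

theory Defs
  imports "HOL-Analysis.Analysis" "HOL-Algebra.Elementary_Groups"
begin

section \<open>Matrix Painleve II and Baecklund transformations\<close>

text \<open>Points \<open>(p, q, t)\<close> of the extended phase space and parameters \<open>(\<alpha>\<^sub>0, \<alpha>\<^sub>1)\<close>.
  Matrix products are \<open>**\<close>, and \<open>mat c\<close> is \<open>c\<close> times the identity, so the scalar
  multiple of a complex matrix \<open>A\<close> by \<open>c\<close> is \<open>mat c ** A\<close>.\<close>

type_synonym 'n cmat = "complex^'n^'n"
type_synonym 'n ext_phase = "'n cmat \<times> 'n cmat \<times> complex"
type_synonym param = "complex \<times> complex"

definition params :: "param set" where
  "params = {(\<alpha>0, \<alpha>1). \<alpha>0 + \<alpha>1 = 1}"

definition has_matrix_derivative ::
    "(complex \<Rightarrow> 'n::finite cmat) \<Rightarrow> 'n cmat \<Rightarrow> complex \<Rightarrow> bool" where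
  "has_matrix_derivative F D t \<longleftrightarrow>
     (\<forall>i j. ((\<lambda>s. F s $ i $ j) has_field_derivative D $ i $ j) (at t))"

text \<open>The equations of motion \<open>q' = p\<close>, \<open>p' = 2q\<^sup>3 + tq + \<theta>\<close>, where \<open>\<alpha>\<^sub>1 = \<theta> + 1/2\<close>.\<close>

definition PII_solution_on ::
    "param \<Rightarrow> complex set \<Rightarrow> (complex \<Rightarrow> 'n::finite cmat) \<Rightarrow> (complex \<Rightarrow> 'n cmat) \<Rightarrow> bool" where
  "PII_solution_on \<alpha> U p q \<longleftrightarrow>
     (\<forall>t\<in>U. has_matrix_derivative q (p t) t \<and>
            has_matrix_derivative p
              (mat 2 ** (q t ** q t ** q t) + mat t ** q t + mat (snd \<alpha> - 1/2)) t)"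

text \<open>A solution is identified with its curve in the extended phase space, so that
  transformations of that space (which may move \<open>t\<close>) act on solutions.\<close>

definition PII_solutions :: "param \<Rightarrow> 'n::finite ext_phase set set" where
  "PII_solutions \<alpha> = {(\<lambda>t. (p t, q t, t)) ` U | U p q. open U \<and> PII_solution_on \<alpha> U p q}"

text \<open>\<open>\<D> a\<close> is the set of solution curves at parameter \<open>a \<in> A\<close>. The map \<open>\<pi>\<close> on the extended
  phase space may depend on the parameter and may be partial; a solution curve is transformed
  wherever \<open>\<pi>\<close> is defined on it.\<close>

definition baecklund_transformation ::
    "'a set \<Rightarrow> ('a \<Rightarrow> 'm set set) \<Rightarrow> ('a \<Rightarrow> 'm \<rightharpoonup> 'm) \<Rightarrow> ('a \<Rightarrow> 'a) \<Rightarrow> bool" where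
  "baecklund_transformation A \<D> \<pi> \<pi>' \<longleftrightarrow>
     (\<forall>a\<in>A. \<pi>' a \<in> A \<and> (\<forall>S\<in>\<D> a. {y. \<exists>x\<in>S. \<pi> a x = Some y} \<in> \<D> (\<pi>' a)))"

fun s1_phase :: "param \<Rightarrow> 'n::finite ext_phase \<rightharpoonup> 'n ext_phase" where
  "s1_phase (\<alpha>0, \<alpha>1) (p, q, t) =
     (let f = p + q ** q + mat (t/2); g = matrix_inv f in
      if invertible f
      then Some (p - mat \<alpha>1 ** (q ** g + g ** q) - mat (\<alpha>1\<^sup>2) ** (g ** g), q + mat \<alpha>1 ** g, t)
      else None)"

fun s1_param :: "param \<Rightarrow> param" where
  "s1_param (\<alpha>0, \<alpha>1) = (\<alpha>0 + 2 * \<alpha>1, - \<alpha>1)"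

fun r_phase :: "param \<Rightarrow> 'n::finite ext_phase \<rightharpoonup> 'n ext_phase" where
  "r_phase \<alpha> (p, q, t) = Some (- p, - q, t)"

fun r_param :: "param \<Rightarrow> param" where
  "r_param (\<alpha>0, \<alpha>1) = (\<alpha>1, \<alpha>0)"


section \<open>Birational transformations of the variables and parameters\<close>

text \<open>The ambient variety is the affine space of all \<open>((p, q, t), (\<alpha>\<^sub>0, \<alpha>\<^sub>1))\<close> with
  \<open>\<alpha>\<^sub>0 + \<alpha>\<^sub>1 = 1\<close>.\<close>

type_synonym 'n point = "'n ext_phase \<times> param"

definition variety :: "'n::finite point set" where
  "variety = UNIV \<times> params"

definition coordinates :: "('n::finite point \<Rightarrow> complex) set" where
  "coordinates =
     {\<lambda>((p, q, t), \<alpha>). p $ i $ j | i j. True} \<union> {\<lambda>((p, q, t), \<alpha>). q $ i $ j | i j. True} \<union>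
     {\<lambda>((p, q, t), \<alpha>). t, \<lambda>(x, (\<alpha>0, \<alpha>1)). \<alpha>0, \<lambda>(x, (\<alpha>0, \<alpha>1)). \<alpha>1}"

inductive polyfun :: "('n::finite point \<Rightarrow> complex) \<Rightarrow> bool" where
  const: "polyfun (\<lambda>x. c)"
| coord: "c \<in> coordinates \<Longrightarrow> polyfun c"
| add: "polyfun f \<Longrightarrow> polyfun g \<Longrightarrow> polyfun (\<lambda>x. f x + g x)"
| mult: "polyfun f \<Longrightarrow> polyfun g \<Longrightarrow> polyfun (\<lambda>x. f x * g x)"

definition basic_open :: "('n::finite point \<Rightarrow> complex) \<Rightarrow> 'n point set" where
  "basic_open g = {x \<in> variety. g x \<noteq> 0}"

definition dense_basic_open :: "'n::finite point set \<Rightarrow> bool" where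
  "dense_basic_open U \<longleftrightarrow> U \<noteq> {} \<and> (\<exists>g. polyfun g \<and> U = basic_open g)"

text \<open>Rational maps are represented by partial functions that are defined exactly on a
  non-empty (hence Zariski dense) basic open set and are regular there. Regular functions on
  \<open>basic_open g\<close> have the form \<open>h / g ^ k\<close>; replacing \<open>g\<close> by a power of itself does not change
  \<open>basic_open g\<close>, so one denominator serves all coordinates.\<close>

definition rational_map :: "('n::finite point \<rightharpoonup> 'n point) \<Rightarrow> bool" where
  "rational_map \<phi> \<longleftrightarrow>
     dom \<phi> \<noteq> {} \<and> ran \<phi> \<subseteq> variety \<and>
     (\<exists>g. polyfun g \<and> dom \<phi> = basic_open g \<and>
        (\<forall>c\<in>coordinates. \<exists>h. polyfun h \<and> (\<forall>x\<in>dom \<phi>. c (the (\<phi> x)) = h x / g x)))"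

definition generically_eq ::
    "('n::finite point \<rightharpoonup> 'n point) \<Rightarrow> ('n point \<rightharpoonup> 'n point) \<Rightarrow> bool" where
  "generically_eq \<phi> \<psi> \<longleftrightarrow>
     (\<exists>U. dense_basic_open U \<and> U \<subseteq> dom \<phi> \<and> U \<subseteq> dom \<psi> \<and> (\<forall>x\<in>U. \<phi> x = \<psi> x))"

definition identity_map :: "'n::finite point \<rightharpoonup> 'n point" where
  "identity_map = Some |` variety"

definition birational_map :: "('n::finite point \<rightharpoonup> 'n point) \<Rightarrow> bool" where
  "birational_map \<phi> \<longleftrightarrow> rational_map \<phi> \<and>
     (\<exists>\<psi>. rational_map \<psi> \<and> generically_eq (\<psi> \<circ>\<^sub>m \<phi>) identity_map \<and>
          generically_eq (\<phi> \<circ>\<^sub>m \<psi>) identity_map)"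

definition birational_class ::
    "('n::finite point \<rightharpoonup> 'n point) \<Rightarrow> ('n point \<rightharpoonup> 'n point) set" where
  "birational_class \<phi> = {\<psi>. birational_map \<psi> \<and> generically_eq \<phi> \<psi>}"

text \<open>The group of birational self-maps of \<open>variety\<close>; in a product \<open>a \<otimes> b\<close> the map \<open>b\<close> is
  applied first.\<close>

definition birational_group :: "('n::finite point \<rightharpoonup> 'n point) set monoid" where
  "birational_group =
     \<lparr>carrier = birational_class ` {\<phi>. birational_map \<phi>},
      mult = (\<lambda>a b. \<Union>\<phi>\<in>a. \<Union>\<psi>\<in>b. birational_class (\<phi> \<circ>\<^sub>m \<psi>)),
      one = birational_class identity_map\<rparr>"

definition extended_map ::
    "(param \<Rightarrow> 'n::finite ext_phase \<rightharpoonup> 'n ext_phase) \<Rightarrow> (param \<Rightarrow> param) \<Rightarrow> 'n point \<rightharpoonup> 'n point" where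
  "extended_map \<pi> \<pi>' =
     (\<lambda>(x, \<alpha>). if \<alpha> \<in> params then map_option (\<lambda>y. (y, \<pi>' \<alpha>)) (\<pi> \<alpha> x) else None)"

definition s1_transformation :: "('n::finite point \<rightharpoonup> 'n point) set" where
  "s1_transformation = birational_class (extended_map s1_phase s1_param)"

definition r_transformation :: "('n::finite point \<rightharpoonup> 'n point) set" where
  "r_transformation = birational_class (extended_map r_phase r_param)"


section \<open>The group \<open>C\<^sub>2 \<ltimes> W(A\<^sub>1\<^sup>(\<^sup>1\<^sup>))\<close>\<close>

datatype simple_refl = S0 | S1

text \<open>Words modulo the relations \<open>S0\<^sup>2 = S1\<^sup>2 = 1\<close> only. No formal inverses are needed,
  since these relations make the generators involutions.\<close>

inductive word_eq :: "simple_refl list \<Rightarrow> simple_refl list \<Rightarrow> bool" where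
  refl: "word_eq u u"
| sym: "word_eq u v \<Longrightarrow> word_eq v u"
| trans: "word_eq u v \<Longrightarrow> word_eq v w \<Longrightarrow> word_eq u w"
| cancel: "word_eq (u @ [s, s] @ v) (u @ v)"

definition word_class :: "simple_refl list \<Rightarrow> simple_refl list set" where
  "word_class u = {v. word_eq u v}"

definition affine_weyl_A1 :: "simple_refl list set monoid" where
  "affine_weyl_A1 =
     \<lparr>carrier = range word_class,
      mult = (\<lambda>a b. \<Union>u\<in>a. \<Union>v\<in>b. word_class (u @ v)),
      one = word_class []\<rparr>"

fun swap_refl :: "simple_refl \<Rightarrow> simple_refl" where
  "swap_refl S0 = S1"
| "swap_refl S1 = S0"

text \<open>The action of \<open>C\<^sub>2 = {0, 1}\<close> (written additively) whose generator \<open>1\<close> exchanges the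
  simple reflections.\<close>

definition swap_action :: "int \<Rightarrow> simple_refl list set \<Rightarrow> simple_refl list set" where
  "swap_action c a = (if c = 0 then a else map swap_refl ` a)"

text \<open>\<open>(h, n)\<close> stands for the product \<open>nh\<close>, and \<open>\<phi> h\<close> for conjugation by \<open>h\<close>:
  \<open>nh n'h' = n (hn'h\<^sup>-\<^sup>1) hh'\<close>.\<close>

definition semidirect_product ::
    "'h monoid \<Rightarrow> ('h \<Rightarrow> 'n \<Rightarrow> 'n) \<Rightarrow> 'n monoid \<Rightarrow> ('h \<times> 'n) monoid" where
  "semidirect_product H \<phi> N =
     \<lparr>carrier = carrier H \<times> carrier N,
      mult = (\<lambda>(h, n) (h', n'). (h \<otimes>\<^bsub>H\<^esub> h', n \<otimes>\<^bsub>N\<^esub> \<phi> h n')),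
      one = (\<one>\<^bsub>H\<^esub>, \<one>\<^bsub>N\<^esub>)\<rparr>"

definition C2_ltimes_affine_weyl_A1 :: "(int \<times> simple_refl list set) monoid" where
  "C2_ltimes_affine_weyl_A1 =
     semidirect_product (integer_mod_group 2) swap_action affine_weyl_A1"

end

theory Submission
  imports Defs
begin

text \<open>In the variables \<open>(q, f)\<close> the system becomes \<open>q' = f - q\<^sup>2 - t/2\<close>, \<open>f' = qf + fq + \<alpha>\<^sub>1\<close>,
  and \<open>s\<^sub>1\<close> fixes \<open>f\<close> and moves \<open>q\<close> to \<open>q + \<alpha>\<^sub>1 f\<^sup>-\<^sup>1\<close>; the non-commutative product rule then
  shows that \<open>s\<^sub>1\<close> is a Baecklund transformation and an involution. The relations between the
  generators are therefore immediate, and there are no others because the group already acts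
  faithfully on \<open>\<alpha>\<^sub>1\<close>: \<open>s\<^sub>1\<close>, \<open>r\<close> and \<open>s\<^sub>0\<close> act as \<open>a \<mapsto> -a\<close>, \<open>a \<mapsto> 1 - a\<close> and \<open>a \<mapsto> 2 - a\<close>, so words
  in \<open>s\<^sub>0, s\<^sub>1\<close> give exactly the maps \<open>a \<mapsto> \<plusminus>a + 2k\<close>, and a factor \<open>r\<close> makes the constant odd.\<close>

section \<open>Matrices\<close>

text \<open>Non-commutativity costs little because \<open>f\<close> commutes with
  \<open>f\<^sup>-\<^sup>1\<close>: the only ordered products that survive are
  \<open>q f\<^sup>-\<^sup>1\<close> and \<open>f\<^sup>-\<^sup>1 q\<close>, and these are exactly
  the cross terms in the square of the new \<open>q\<close>. The harder obstacle is the ambient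
  group. Its elements are classes of partial maps that agree on a non-empty basic open set, and
  composing representatives shrinks domains. Two facts keep this under control: non-empty basic open
  sets always meet, and a birational map pulls such a set back to such a set. They make the product
  well defined, and the first also makes the affine action on \<open>\<alpha>\<^sub>1\<close> an
  invariant of a class, so that an equation between classes can be read off as an equation between
  integers. Injectivity then involves no matrices; it compares signs, parities and translation
  lengths of words in the infinite dihedral group.\<close>

lemma matrix_mul_minus_left: "(- A) ** B = - (A ** B)" for A :: "'a::ring_1^'n^'m"
  by (simp add: vec_eq_iff matrix_matrix_mult_def sum_negf)

lemma matrix_mul_minus_right: "A ** (- B) = - (A ** B)" for A :: "'a::ring_1^'n^'m"
  by (simp add: vec_eq_iff matrix_matrix_mult_def sum_negf)

lemma matrix_diff_ldistrib: "A ** (B - C) = A ** B - A ** C" for A :: "'a::ring_1^'n^'m"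
  by (simp add: vec_eq_iff matrix_matrix_mult_def sum_subtractf right_diff_distrib)

lemma matrix_diff_rdistrib: "(A - B) ** C = A ** C - B ** C" for A :: "'a::ring_1^'n^'m"
  by (simp add: vec_eq_iff matrix_matrix_mult_def sum_subtractf left_diff_distrib)

lemma matrix_add_rdistrib: "(A + B) ** C = A ** C + B ** C" for A :: "'a::semiring_1^'n^'m"
  by (simp add: vec_eq_iff matrix_matrix_mult_def sum.distrib distrib_right)

lemma mat_mul_nth: "(mat c ** A) $ i $ j = c * A $ i $ j" for A :: "'a::semiring_1^'n^'m"
  by (simp add: matrix_matrix_mult_def mat_def if_distrib[of "\<lambda>x. x * _"] cong: if_cong)

lemma mul_mat_nth: "(A ** mat c) $ i $ j = A $ i $ j * c" for A :: "'a::semiring_1^'n^'m"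
  by (simp add: matrix_matrix_mult_def mat_def if_distrib[of "\<lambda>x. _ * x"] cong: if_cong)

lemma mat_minus: "mat (- c) = - mat c" for c :: "'a::ring_1"
  by (simp add: vec_eq_iff mat_def)

lemma mat_diff: "mat (c - d) = mat c - mat d" for c :: "'a::ring_1"
  by (simp add: vec_eq_iff mat_def)

text \<open>Scalar multiples in a form that the simplifier can pull out of products; with
  \<open>mat c ** A\<close> itself the commutation rule would loop.\<close>

definition mat_scale :: "'a::comm_ring_1 \<Rightarrow> 'a^'n^'n \<Rightarrow> 'a^'n^'n" where
  "mat_scale c A = mat c ** A"

lemma mat_scale_nth: "mat_scale c A $ i $ j = c * A $ i $ j"
  by (simp add: mat_scale_def mat_mul_nth)

lemma mat_scale_simps:
  "mat c ** A = mat_scale c A"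
  "A ** mat c = mat_scale c A"
  "mat_scale c A ** B = mat_scale c (A ** B)"
  "A ** mat_scale c B = mat_scale c (A ** B)"
  "mat_scale c (mat d) = mat (c * d)"
  "mat_scale c (mat_scale d A) = mat_scale (c * d) A"
  "mat_scale c (A + B) = mat_scale c A + mat_scale c B"
  "mat_scale c (A - B) = mat_scale c A - mat_scale c B"
  "mat_scale c (- A) = - mat_scale c A"
proof -
  show "A ** mat c = mat_scale c A"
    by (simp add: vec_eq_iff mat_scale_nth mul_mat_nth)
  show "mat_scale c A ** B = mat_scale c (A ** B)"
    by (simp add: mat_scale_def matrix_mul_assoc)
  show "A ** mat_scale c B = mat_scale c (A ** B)"
    by (simp add: vec_eq_iff mat_scale_nth matrix_matrix_mult_def sum_distrib_left mult.left_commute)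
qed (simp add: mat_scale_def, simp_all add: vec_eq_iff mat_scale_nth algebra_simps, simp add: mat_def)

lemmas matrix_ring_simps = matrix_add_ldistrib matrix_add_rdistrib matrix_diff_ldistrib
  matrix_diff_rdistrib matrix_mul_minus_left matrix_mul_minus_right matrix_mul_assoc
  mat_scale_simps

lemma
  fixes A :: "'a::semiring_1^'n^'m"
  assumes "invertible A"
  shows matrix_inv_right: "A ** matrix_inv A = mat 1"
    and matrix_inv_left: "matrix_inv A ** A = mat 1"
proof -
  have "A ** matrix_inv A = mat 1 \<and> matrix_inv A ** A = mat 1"
    using assms unfolding invertible_def matrix_inv_def by (rule someI_ex)
  then show "A ** matrix_inv A = mat 1" "matrix_inv A ** A = mat 1" by auto
qed

text \<open>Cramer's rule, applied to each column of \<open>A ** matrix_inv A = mat 1\<close>. The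
  quotient of determinants is what makes the inverse differentiable along a solution and rational on
  the variety.\<close>

lemma matrix_inv_nth:
  fixes A :: "'a::field^'n^'n"
  assumes "invertible A"
  shows "matrix_inv A $ k $ l =
    det (\<chi> i j. if j = k then mat 1 $ i $ l else A $ i $ j) / det A"
proof -
  have d: "det A \<noteq> 0" using assms by (simp add: invertible_det_nz)
  have "A *v column l (matrix_inv A) = column l (A ** matrix_inv A)"
    by (simp add: vec_eq_iff column_def matrix_matrix_mult_def matrix_vector_mult_def)
  also have "\<dots> = column l (mat 1)"
    using assms by (simp add: matrix_inv_right)
  finally have "column l (matrix_inv A) =
      (\<chi> k. det (\<chi> i j. if j = k then column l (mat 1) $ i else A $ i $ j) / det A)"
    using cramer[OF d] by blast
  then have "column l (matrix_inv A) $ k =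
      det (\<chi> i j. if j = k then column l (mat 1) $ i else A $ i $ j) / det A"
    by simp
  then show ?thesis by (simp add: column_def cong: if_cong)
qed

section \<open>Derivatives of matrix functions\<close>

lemma has_matrix_derivative_const: "has_matrix_derivative (\<lambda>s. A) 0 t"
  by (simp add: has_matrix_derivative_def)

lemma has_matrix_derivative_mat:
  "(c has_field_derivative d) (at t) \<Longrightarrow> has_matrix_derivative (\<lambda>s. mat (c s)) (mat d) t"
  by (auto simp: has_matrix_derivative_def mat_def)

lemma has_matrix_derivative_add:
  "has_matrix_derivative F D t \<Longrightarrow> has_matrix_derivative G E t \<Longrightarrow>
    has_matrix_derivative (\<lambda>s. F s + G s) (D + E) t"
  by (auto simp: has_matrix_derivative_def intro!: derivative_intros)

lemma has_matrix_derivative_diff: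
  "has_matrix_derivative F D t \<Longrightarrow> has_matrix_derivative G E t \<Longrightarrow>
    has_matrix_derivative (\<lambda>s. F s - G s) (D - E) t"
  by (auto simp: has_matrix_derivative_def intro!: derivative_intros)

lemma has_matrix_derivative_minus:
  "has_matrix_derivative F D t \<Longrightarrow> has_matrix_derivative (\<lambda>s. - F s) (- D) t"
  by (auto simp: has_matrix_derivative_def intro!: derivative_intros)

lemma has_matrix_derivative_mul:
  assumes "has_matrix_derivative F D t" "has_matrix_derivative G E t"
  shows "has_matrix_derivative (\<lambda>s. F s ** G s) (D ** G t + F t ** E) t"
  unfolding has_matrix_derivative_def
proof (intro allI)
  fix i j
  have "((\<lambda>s. \<Sum>k\<in>UNIV. F s $ i $ k * G s $ k $ j) has_field_derivative
      (\<Sum>k\<in>UNIV. F t $ i $ k * E $ k $ j + D $ i $ k * G t $ k $ j)) (at t)"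
    using assms by (auto simp: has_matrix_derivative_def intro!: DERIV_sum DERIV_mult')
  then show "((\<lambda>s. (F s ** G s) $ i $ j) has_field_derivative (D ** G t + F t ** E) $ i $ j) (at t)"
    by (simp add: matrix_matrix_mult_def sum.distrib add.commute)
qed

lemma has_matrix_derivative_unique:
  "has_matrix_derivative F D t \<Longrightarrow> has_matrix_derivative F E t \<Longrightarrow> D = E"
  unfolding has_matrix_derivative_def vec_eq_iff by (metis DERIV_unique)

lemma has_matrix_derivative_transform:
  assumes "has_matrix_derivative F D t" "open U" "t \<in> U" "\<And>s. s \<in> U \<Longrightarrow> F s = G s"
  shows "has_matrix_derivative G D t"
  unfolding has_matrix_derivative_def
proof (intro allI)
  fix i j
  show "((\<lambda>s. G s $ i $ j) has_field_derivative D $ i $ j) (at t)"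
    by (rule has_field_derivative_transform_within_open[of "\<lambda>s. F s $ i $ j" _ _ U])
       (use assms in \<open>auto simp: has_matrix_derivative_def\<close>)
qed

lemma det_differentiable:
  assumes "\<And>i j. (\<lambda>s. F s $ i $ j) field_differentiable (at t)"
  shows "(\<lambda>s. det (F s :: complex^'n^'n)) field_differentiable (at t)"
proof -
  obtain D where D: "\<And>i j. ((\<lambda>s. F s $ i $ j) has_field_derivative D i j) (at t)"
    using assms unfolding field_differentiable_def by metis
  have "(\<lambda>s. \<Prod>i\<in>UNIV. F s $ i $ p i) field_differentiable (at t)" for p
    unfolding field_differentiable_def 
    by (rule exI, rule has_field_derivative_prod[where f = "\<lambda>i s. F s $ i $ p i"], rule D)
  then show ?thesis
    unfolding det_def by (intro field_differentiable_sum field_differentiable_mult) auto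
qed

lemma has_matrix_derivative_det:
  "has_matrix_derivative F D t \<Longrightarrow> (\<lambda>s. det (F s)) field_differentiable (at t)"
  by (rule det_differentiable) (auto simp: has_matrix_derivative_def field_differentiable_def)

text \<open>Continuity of the determinant. A transformed solution lives where \<open>f\<close> is
  invertible, and \<open>PII_solutions\<close> asks for an open set of times.\<close>

lemma open_invertible:
  assumes "open U" "\<And>t. t \<in> U \<Longrightarrow> has_matrix_derivative F (D t) t"
  shows "open {t \<in> U. invertible (F t)}"
proof -
  have "continuous_on U (\<lambda>s. det (F s))"
    by (intro continuous_at_imp_continuous_on ballI field_differentiable_imp_continuous_at
        has_matrix_derivative_det[OF assms(2)])
  then have "open (U \<inter> (\<lambda>s. det (F s)) -` (- {0}))"
    using assms(1) by (intro continuous_open_preimage) auto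
  moreover have "U \<inter> (\<lambda>s. det (F s)) -` (- {0}) = {t \<in> U. invertible (F t)}"
    by (auto simp: invertible_det_nz)
  ultimately show ?thesis by simp
qed

text \<open>Cramer's quotients show only that some derivative exists. Its value follows by
  differentiating the constant \<open>F s ** matrix_inv (F s)\<close> and multiplying on the left by
  the inverse.\<close>

lemma has_matrix_derivative_inv:
  assumes "open U" "t \<in> U" and D: "\<And>s. s \<in> U \<Longrightarrow> has_matrix_derivative F (D s) s"
    and inv: "\<And>s. s \<in> U \<Longrightarrow> invertible (F s)"
  shows "has_matrix_derivative (\<lambda>s. matrix_inv (F s))
    (- (matrix_inv (F t) ** D t ** matrix_inv (F t))) t"
proof -
  let ?g = "\<lambda>s. matrix_inv (F s)"
  have "(\<lambda>s. ?g s $ k $ l) field_differentiable (at t)" for k l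
  proof -
    have F: "(\<lambda>s. F s $ i $ j) field_differentiable (at t)" for i j
      using D[OF assms(2)] by (auto simp: has_matrix_derivative_def field_differentiable_def)
    have "(\<lambda>s. (\<chi> i j. if j = k then mat 1 $ i $ l else F s $ i $ j) $ i $ j)
        field_differentiable (at t)" for i j
      by (cases "j = k") (simp_all add: F)
    then have "(\<lambda>s. det (\<chi> i j. if j = k then mat 1 $ i $ l else F s $ i $ j) / det (F s))
        field_differentiable (at t)"
      using inv[OF assms(2)]
      by (intro field_differentiable_divide det_differentiable F) (auto simp: invertible_det_nz)
    then obtain d where "((\<lambda>s. det (\<chi> i j. if j = k then mat 1 $ i $ l else F s $ i $ j) / det (F s))
        has_field_derivative d) (at t)"
      by (auto simp: field_differentiable_def)
    then have "((\<lambda>s. ?g s $ k $ l) has_field_derivative d) (at t)"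
      by (rule has_field_derivative_transform_within_open[OF _ assms(1,2)])
         (simp add: matrix_inv_nth inv)
    then show ?thesis by (auto simp: field_differentiable_def)
  qed
  then obtain E' where "\<And>k l. ((\<lambda>s. ?g s $ k $ l) has_field_derivative E' k l) (at t)"
    unfolding field_differentiable_def by metis
  then have E: "has_matrix_derivative ?g (\<chi> k l. E' k l) t"
    by (simp add: has_matrix_derivative_def)
  define E where "E = (\<chi> k l. E' k l)"
  have "has_matrix_derivative (\<lambda>s. F s ** ?g s) (D t ** ?g t + F t ** E) t"
    unfolding E_def by (intro has_matrix_derivative_mul D assms(2) E)
  moreover have "has_matrix_derivative (\<lambda>s. F s ** ?g s) 0 t"
    by (rule has_matrix_derivative_transform[OF has_matrix_derivative_const[of "mat 1"] assms(1,2)])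
       (simp add: matrix_inv_right inv)
  ultimately have "D t ** ?g t + F t ** E = 0"
    by (rule has_matrix_derivative_unique)
  then have "F t ** E = - (D t ** ?g t)"
    by (simp add: eq_neg_iff_add_eq_0 add.commute)
  then have "?g t ** (F t ** E) = - (?g t ** D t ** ?g t)"
    by (simp add: matrix_mul_minus_right matrix_mul_assoc)
  then have "E = - (?g t ** D t ** ?g t)"
    using inv[OF assms(2)] by (simp add: matrix_mul_assoc matrix_inv_left)
  then show ?thesis using E E_def by simp
qed

section \<open>Baecklund transformations\<close>

definition PII_f :: "'n::finite cmat \<Rightarrow> 'n cmat \<Rightarrow> complex \<Rightarrow> 'n cmat" where
  "PII_f p q t = p + q ** q + mat (t/2)"

text \<open>Given \<open>q' = p\<close>, the derivative of \<open>f\<close> is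
  \<open>p' + pq + qp + 1/2\<close>, and \<open>2q^3 + tq + pq + qp\<close> is the ordered sum
  \<open>qf + fq\<close>. The derivative \<open>1/2\<close> of \<open>t/2\<close> turns
  \<open>\<theta>\<close> into \<open>\<alpha>\<^sub>1\<close>.\<close>

lemma PII_solution_on_iff:
  "PII_solution_on \<alpha> U p q \<longleftrightarrow>
     (\<forall>t\<in>U. has_matrix_derivative q (p t) t \<and>
        has_matrix_derivative (\<lambda>t. PII_f (p t) (q t) t)
          (q t ** PII_f (p t) (q t) t + PII_f (p t) (q t) t ** q t + mat (snd \<alpha>)) t)"
proof -
  have "has_matrix_derivative p
          (mat 2 ** (q t ** q t ** q t) + mat t ** q t + mat (snd \<alpha> - 1/2)) t \<longleftrightarrow>
        has_matrix_derivative (\<lambda>t. PII_f (p t) (q t) t)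
          (q t ** PII_f (p t) (q t) t + PII_f (p t) (q t) t ** q t + mat (snd \<alpha>)) t"
    (is "has_matrix_derivative p ?X t \<longleftrightarrow> has_matrix_derivative ?f ?Y t")
    if q: "has_matrix_derivative q (p t) t" for t
  proof -
    have c: "has_matrix_derivative (\<lambda>t. q t ** q t + mat (t/2))
        (p t ** q t + q t ** p t + mat (1/2)) t" (is "has_matrix_derivative ?c ?C t")
      by (intro has_matrix_derivative_add has_matrix_derivative_mul has_matrix_derivative_mat q)
         (auto intro!: derivative_eq_intros)
    have Y: "?X + ?C = ?Y"
      by (simp add: PII_f_def matrix_ring_simps mat_diff)
         (simp add: vec_eq_iff mat_scale_nth)
    show ?thesis
    proof
      assume "has_matrix_derivative p ?X t"
      from has_matrix_derivative_add[OF this c] show "has_matrix_derivative ?f ?Y t"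
        unfolding Y by (simp add: PII_f_def add.assoc)
    next
      assume "has_matrix_derivative ?f ?Y t"
      from has_matrix_derivative_diff[OF this c] show "has_matrix_derivative p ?X t"
        unfolding Y[symmetric] by (simp add: PII_f_def add.assoc)
    qed
  qed
  then show ?thesis unfolding PII_solution_on_def by blast
qed

text \<open>The terms subtracted from \<open>p\<close> are precisely those by which the square of
  \<open>q + \<alpha>\<^sub>1 f\<^sup>-\<^sup>1\<close> exceeds the square of
  \<open>q\<close>.\<close>

lemma s1_fixes_f:
  fixes p q :: "'n::finite cmat"
  assumes "s1_phase \<alpha> (p, q, t) = Some (P, Q, t')"
  shows "PII_f P Q t' = PII_f p q t" "t' = t" "invertible (PII_f p q t)"
    "Q = q + mat (snd \<alpha>) ** matrix_inv (PII_f p q t)"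
proof -
  obtain \<alpha>0 \<alpha>1 where \<alpha>: "\<alpha> = (\<alpha>0, \<alpha>1)" by fastforce
  show "t' = t" "invertible (PII_f p q t)"
    "Q = q + mat (snd \<alpha>) ** matrix_inv (PII_f p q t)"
    using assms by (auto simp: \<alpha> Let_def PII_f_def split: if_splits)
  show "PII_f P Q t' = PII_f p q t"
    using assms by (auto simp: \<alpha> Let_def PII_f_def matrix_ring_simps power2_eq_square split: if_splits)
qed

text \<open>Since \<open>f\<close> and \<open>t\<close> are preserved, the new \<open>p\<close> is
  determined by the new \<open>q\<close>. This form spares later arguments the explicit expression
  for \<open>p\<close>.\<close>

lemma s1_phase_eq:
  fixes p q :: "'n::finite cmat" and \<alpha> :: param
  assumes "invertible (PII_f p q t)"
  defines "Q \<equiv> q + mat (snd \<alpha>) ** matrix_inv (PII_f p q t)"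
  shows "s1_phase \<alpha> (p, q, t) = Some (PII_f p q t - Q ** Q - mat (t/2), Q, t)"
proof -
  obtain P Q' t' where s: "s1_phase \<alpha> (p, q, t) = Some (P, Q', t')"
    using assms(1) by (cases \<alpha>) (auto simp: PII_f_def Let_def)
  show ?thesis
    using s1_fixes_f[OF s] s by (auto simp: PII_f_def Q_def algebra_simps)
qed

lemma s1_phase_None:
  "\<not> invertible (PII_f p q t) \<Longrightarrow> s1_phase \<alpha> (p, q, t) = None"
  by (cases \<alpha>) (auto simp: PII_f_def Let_def)

text \<open>Both equations in \<open>(q, f)\<close> are verified with \<open>f\<close> held fixed:
  moving \<open>q\<close> by \<open>a g\<close> adds \<open>2a\<close> to \<open>qf + fq\<close>,
  which is compensated by replacing \<open>a\<close> by \<open>-a\<close>, and the derivative of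
  \<open>g\<close> supplies the change of \<open>p\<close>.\<close>

lemma PII_solution_on_s1:
  fixes p q :: "complex \<Rightarrow> 'n::finite cmat"
  assumes sol: "PII_solution_on \<alpha> U p q" and U: "open U"
    and inv: "\<And>t. t \<in> U \<Longrightarrow> invertible (PII_f (p t) (q t) t)"
  defines "Q \<equiv> \<lambda>t. q t + mat (snd \<alpha>) ** matrix_inv (PII_f (p t) (q t) t)"
  defines "P \<equiv> \<lambda>t. PII_f (p t) (q t) t - Q t ** Q t - mat (t/2)"
  shows "PII_solution_on (s1_param \<alpha>) U P Q"
  unfolding PII_solution_on_iff
proof (intro ballI conjI)
  fix t assume t: "t \<in> U"
  define f where "f = (\<lambda>t. PII_f (p t) (q t) t)"
  define g where "g = matrix_inv (f t)"
  define a where "a = snd \<alpha>"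
  have f_eq: "PII_f (p s) (q s) s = f s" for s by (simp add: f_def)
  have a: "snd (s1_param \<alpha>) = - a" by (cases \<alpha>) (simp add: a_def)
  have f: "has_matrix_derivative f (q s ** f s + f s ** q s + mat a) s"
    and q: "has_matrix_derivative q (p s) s" if "s \<in> U" for s
    using sol that by (auto simp: PII_solution_on_iff f_def a_def)
  have gf: "g ** f t = mat 1" and fg: "f t ** g = mat 1"
    using inv[OF t] by (auto simp: g_def f_def matrix_inv_left matrix_inv_right)
  have p: "p t = f t - q t ** q t - mat (t/2)"
    by (simp add: f_def PII_f_def)
  have Qt: "Q t = q t + mat a ** g" by (simp add: Q_def a_def f_def g_def)
  have "has_matrix_derivative (\<lambda>s. matrix_inv (f s)) (- (g ** (q t ** f t + f t ** q t + mat a) ** g)) t"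
    unfolding g_def using inv by (intro has_matrix_derivative_inv[OF U t f]) (auto simp: f_def)
  \<comment> \<open>Each outer \<open>g\<close> cancels the adjacent \<open>f\<close>, so
    \<open>q\<close> never has to be commuted past \<open>f\<close>.\<close>
  also have "g ** (q t ** f t + f t ** q t + mat a) ** g =
      g ** q t ** (f t ** g) + (g ** f t) ** q t ** g + mat a ** g ** g"
    by (simp add: matrix_ring_simps)
  also have "\<dots> = g ** q t + q t ** g + mat a ** g ** g"
    by (simp add: fg gf)
  finally have "has_matrix_derivative Q
      (p t + (0 ** matrix_inv (f t) + mat a ** (- (g ** q t + q t ** g + mat a ** g ** g)))) t"
    unfolding Q_def f_eq a_def[symmetric]
    by (intro has_matrix_derivative_add has_matrix_derivative_mul q t has_matrix_derivative_const)
  \<comment> \<open>With \<open>p = f - q^2 - t/2\<close> this completes the square of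
    \<open>q + a g\<close>.\<close>
  also have "p t + (0 ** matrix_inv (f t) + mat a ** (- (g ** q t + q t ** g + mat a ** g ** g))) = P t"
    unfolding p P_def f_eq Qt by (simp add: matrix_ring_simps)
  finally show "has_matrix_derivative Q (P t) t" .
  have PQ: "PII_f (P s) (Q s) s = f s" for s
    by (simp add: P_def PII_f_def f_def)
  have "q t ** f t + f t ** q t + mat a = Q t ** f t + f t ** Q t + mat (- a)"
  proof -
    have "Q t ** f t + f t ** Q t =
        q t ** f t + f t ** q t + (mat a ** (g ** f t) + mat a ** (f t ** g))"
      unfolding Qt by (simp add: matrix_ring_simps)
    then show ?thesis by (simp add: fg gf mat_minus)
  qed
  with f[OF t] show "has_matrix_derivative (\<lambda>t. PII_f (P t) (Q t) t)
      (Q t ** PII_f (P t) (Q t) t + PII_f (P t) (Q t) t ** Q t + mat (snd (s1_param \<alpha>))) t"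
    unfolding PQ a by simp
qed

lemma s1_param_params: "\<alpha> \<in> params \<Longrightarrow> s1_param \<alpha> \<in> params"
  by (cases \<alpha>) (simp add: params_def add.commute)

lemma r_param_params: "\<alpha> \<in> params \<Longrightarrow> r_param \<alpha> \<in> params"
  by (cases \<alpha>) (simp add: params_def add.commute)

lemma PII_solution_on_subset:
  "PII_solution_on \<alpha> U p q \<Longrightarrow> V \<subseteq> U \<Longrightarrow> PII_solution_on \<alpha> V p q"
  by (auto simp: PII_solution_on_def)

text \<open>Times at which \<open>f\<close> is singular drop out, leaving the open set
  \<open>V\<close>. If \<open>V\<close> is empty, the image is the empty curve, which also belongs
  to \<open>PII_solutions\<close>.\<close>

lemma baecklund_s1:
  "baecklund_transformation params (PII_solutions :: param \<Rightarrow> 'n::finite ext_phase set set)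
     s1_phase s1_param"
  unfolding baecklund_transformation_def
proof (intro ballI conjI s1_param_params)
  fix \<alpha> and S :: "'n ext_phase set"
  assume "S \<in> PII_solutions \<alpha>"
  then obtain U p q where S: "S = (\<lambda>t. (p t, q t, t)) ` U" and U: "open U"
    and sol: "PII_solution_on \<alpha> U p q"
    by (auto simp: PII_solutions_def)
  define V where "V = {t \<in> U. invertible (PII_f (p t) (q t) t)}"
  define Q where "Q = (\<lambda>t. q t + mat (snd \<alpha>) ** matrix_inv (PII_f (p t) (q t) t))"
  define P where "P = (\<lambda>t. PII_f (p t) (q t) t - Q t ** Q t - mat (t/2))"
  have V: "open V"
    unfolding V_def by (rule open_invertible[OF U]) (use sol in \<open>auto simp: PII_solution_on_iff\<close>)
  have "{y. \<exists>x\<in>S. s1_phase \<alpha> x = Some y} = (\<lambda>t. (P t, Q t, t)) ` V" (is "?L = ?R")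
  proof
    show "?L \<subseteq> ?R"
    proof
      fix y assume "y \<in> ?L"
      then obtain t where t: "t \<in> U" "s1_phase \<alpha> (p t, q t, t) = Some y"
        by (auto simp: S)
      then have i: "invertible (PII_f (p t) (q t) t)"
        using s1_phase_None by (metis option.distinct(1))
      with t show "y \<in> ?R"
        by (auto simp: V_def s1_phase_eq[OF i] P_def Q_def)
    qed
    show "?R \<subseteq> ?L"
    proof
      fix y assume "y \<in> ?R"
      then obtain t where t: "t \<in> U" "invertible (PII_f (p t) (q t) t)" and y: "y = (P t, Q t, t)"
        by (auto simp: V_def)
      then have "s1_phase \<alpha> (p t, q t, t) = Some y"
        by (simp add: s1_phase_eq[OF t(2)] P_def Q_def)
      then show "y \<in> ?L" using t(1) by (auto simp: S simp del: s1_phase.simps)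
    qed
  qed
  moreover have "PII_solution_on (s1_param \<alpha>) V P Q"
    unfolding P_def Q_def
    by (rule PII_solution_on_s1[OF PII_solution_on_subset[OF sol] V]) (auto simp: V_def)
  ultimately show "{y. \<exists>x\<in>S. s1_phase \<alpha> x = Some y} \<in> PII_solutions (s1_param \<alpha>)"
    using V unfolding PII_solutions_def by blast
qed

text \<open>The cubic and linear terms are odd in \<open>q\<close>, and
  \<open>\<alpha>\<^sub>0 + \<alpha>\<^sub>1 = 1\<close> says exactly that exchanging the parameters
  changes the sign of \<open>\<theta>\<close>.\<close>

lemma baecklund_r:
  "baecklund_transformation params (PII_solutions :: param \<Rightarrow> 'n::finite ext_phase set set)
     r_phase r_param"
  unfolding baecklund_transformation_def
proof (intro ballI conjI r_param_params)
  fix \<alpha> and S :: "'n ext_phase set"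
  assume \<alpha>: "\<alpha> \<in> params" and "S \<in> PII_solutions \<alpha>"
  then obtain U p q where S: "S = (\<lambda>t. (p t, q t, t)) ` U" and U: "open U"
    and sol: "PII_solution_on \<alpha> U p q"
    by (auto simp: PII_solutions_def)
  have \<theta>: "snd (r_param \<alpha>) - 1/2 = - (snd \<alpha> - 1/2)"
    using \<alpha> by (cases \<alpha>) (auto simp: params_def algebra_simps)
  then have "PII_solution_on (r_param \<alpha>) U (\<lambda>t. - p t) (\<lambda>t. - q t)"
    unfolding PII_solution_on_def
  proof (intro ballI conjI)
    fix t assume "t \<in> U"
    with sol have q: "has_matrix_derivative q (p t) t"
      and p: "has_matrix_derivative p
          (mat 2 ** (q t ** q t ** q t) + mat t ** q t + mat (snd \<alpha> - 1/2)) t"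
      by (auto simp: PII_solution_on_def)
    show "has_matrix_derivative (\<lambda>t. - q t) (- p t) t"
      by (rule has_matrix_derivative_minus[OF q])
    show "has_matrix_derivative (\<lambda>t. - p t)
        (mat 2 ** (- q t ** - q t ** - q t) + mat t ** - q t + mat (snd (r_param \<alpha>) - 1/2)) t"
      using has_matrix_derivative_minus[OF p]
      by (simp add: \<theta> mat_minus mat_diff matrix_mul_minus_left matrix_mul_minus_right)
  qed
  moreover have "{y. \<exists>x\<in>S. r_phase \<alpha> x = Some y} = (\<lambda>t. (- p t, - q t, t)) ` U"
    by (auto simp: S)
  ultimately show "{y. \<exists>x\<in>S. r_phase \<alpha> x = Some y} \<in> PII_solutions (r_param \<alpha>)"
    using U unfolding PII_solutions_def mem_Collect_eq
    by (intro exI[of _ U] exI[of _ "\<lambda>t. - p t"] exI[of _ "\<lambda>t. - q t"]) simp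
qed

section \<open>Polynomial functions\<close>

text \<open>Projections replace tuple patterns: finiteness becomes visible, and every coordinate
  takes a form to which the rules for \<open>polyfun\<close> apply.\<close>

lemma coordinates_eq:
  "(coordinates :: ('n::finite point \<Rightarrow> complex) set) =
     (\<lambda>(i, j) x. fst (fst x) $ i $ j) ` UNIV \<union> (\<lambda>(i, j) x. fst (snd (fst x)) $ i $ j) ` UNIV \<union>
     {\<lambda>x. snd (snd (fst x)), \<lambda>x. fst (snd x), \<lambda>x. snd (snd x)}"
proof -
  have eqs: "(\<lambda>((p, q, t), \<alpha>). p $ i $ j) = (\<lambda>x :: 'n point. fst (fst x) $ i $ j)"
    "(\<lambda>((p, q, t), \<alpha>). q $ i $ j) = (\<lambda>x :: 'n point. fst (snd (fst x)) $ i $ j)"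
    "(\<lambda>((p, q, t), \<alpha>). t) = (\<lambda>x :: 'n point. snd (snd (fst x)))"
    "(\<lambda>(x, (\<alpha>0, \<alpha>1)). \<alpha>0) = (\<lambda>x :: 'n point. fst (snd x))"
    "(\<lambda>(x, (\<alpha>0, \<alpha>1)). \<alpha>1) = (\<lambda>x :: 'n point. snd (snd x))" for i j
    by (auto simp: fun_eq_iff)
  show ?thesis unfolding coordinates_def eqs by auto
qed

lemma finite_coordinates: "finite (coordinates :: ('n::finite point \<Rightarrow> complex) set)"
  unfolding coordinates_eq by simp

lemma polyfun_coordinates:
  "polyfun (\<lambda>x. fst (fst x) $ i $ j)"
  "polyfun (\<lambda>x. fst (snd (fst x)) $ i $ j)"
  "polyfun (\<lambda>x. snd (snd (fst x)))"
  "polyfun (\<lambda>x. fst (snd x))"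
  "polyfun (\<lambda>x. snd (snd x))"
  by (rule polyfun.coord; force simp: coordinates_eq image_iff)+

lemma polyfun_minus: "polyfun f \<Longrightarrow> polyfun (\<lambda>x. - f x)"
  using polyfun.mult[OF polyfun.const[of "-1"]] by simp

lemma polyfun_diff: "polyfun f \<Longrightarrow> polyfun g \<Longrightarrow> polyfun (\<lambda>x. f x - g x)"
  using polyfun.add[OF _ polyfun_minus] by simp

lemma polyfun_power: "polyfun f \<Longrightarrow> polyfun (\<lambda>x. f x ^ k)"
  by (induction k) (auto intro: polyfun.const polyfun.mult)

lemma polyfun_sum: "(\<And>i. i \<in> I \<Longrightarrow> polyfun (f i)) \<Longrightarrow> polyfun (\<lambda>x. \<Sum>i\<in>I. f i x)"
  by (induction I rule: infinite_finite_induct) (auto intro: polyfun.const polyfun.add)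

lemma polyfun_prod: "(\<And>i. i \<in> I \<Longrightarrow> polyfun (f i)) \<Longrightarrow> polyfun (\<lambda>x. \<Prod>i\<in>I. f i x)"
  by (induction I rule: infinite_finite_induct) (auto intro: polyfun.const polyfun.mult)

definition polymat :: "('n::finite point \<Rightarrow> 'm::finite cmat) \<Rightarrow> bool" where
  "polymat F \<longleftrightarrow> (\<forall>i j. polyfun (\<lambda>x. F x $ i $ j))"

lemma polyfun_det: "polymat F \<Longrightarrow> polyfun (\<lambda>x. det (F x))"
  unfolding det_def polymat_def
  by (intro polyfun_sum polyfun.mult polyfun.const polyfun_prod) auto

lemma polymat_add: "polymat F \<Longrightarrow> polymat G \<Longrightarrow> polymat (\<lambda>x. F x + G x)"
  by (simp add: polymat_def polyfun.add)

lemma polymat_diff: "polymat F \<Longrightarrow> polymat G \<Longrightarrow> polymat (\<lambda>x. F x - G x)"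
  by (simp add: polymat_def polyfun_diff)

lemma polymat_mul: "polymat F \<Longrightarrow> polymat G \<Longrightarrow> polymat (\<lambda>x. F x ** G x)"
  unfolding polymat_def matrix_matrix_mult_def by (auto intro!: polyfun_sum polyfun.mult)

lemma polymat_mat: "polyfun f \<Longrightarrow> polymat (\<lambda>x. mat (f x))"
  unfolding polymat_def
proof (intro allI)
  fix i j assume "polyfun f"
  then show "polyfun (\<lambda>x. mat (f x) $ i $ j)"
    by (cases "i = j") (simp_all add: mat_def polyfun.const)
qed

section \<open>Density of basic open sets\<close>

definition line_point :: "'n::finite point \<Rightarrow> 'n point \<Rightarrow> complex \<Rightarrow> 'n point" where
  "line_point x y s =
     ((fst (fst x) + mat s ** (fst (fst y) - fst (fst x)),
       fst (snd (fst x)) + mat s ** (fst (snd (fst y)) - fst (snd (fst x))),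
       snd (snd (fst x)) + s * (snd (snd (fst y)) - snd (snd (fst x)))),
      (fst (snd x) + s * (fst (snd y) - fst (snd x)),
       snd (snd x) + s * (snd (snd y) - snd (snd x))))"

lemma coordinates_line_point:
  "c \<in> coordinates \<Longrightarrow> c (line_point x y s) = c x + s * (c y - c x)"
  unfolding coordinates_eq line_point_def by (auto simp: mat_mul_nth)

lemma line_point_0: "line_point x y 0 = x"
  by (simp add: line_point_def prod_eq_iff vec_eq_iff mat_mul_nth)

lemma line_point_1: "line_point x y 1 = y"
  by (simp add: line_point_def prod_eq_iff)

text \<open>The constraint on the parameters is affine, so it persists along affine lines.\<close>

lemma line_point_variety:
  assumes "x \<in> variety" "y \<in> variety"
  shows "line_point x y s \<in> variety"
proof -
  have "fst (snd x) + snd (snd x) = 1" "fst (snd y) + snd (snd y) = 1"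
    using assms by (auto simp: variety_def params_def)
  then have a: "fst (snd x) = 1 - snd (snd x)" "fst (snd y) = 1 - snd (snd y)"
    by (simp_all add: eq_diff_eq)
  show ?thesis
    unfolding variety_def params_def line_point_def a by (simp add: algebra_simps)
qed

lemma polyfun_line_point:
  assumes "polyfun f"
  shows "\<exists>P. \<forall>s. f (line_point x y s) = poly P s"
  using assms
proof (induction rule: polyfun.induct)
  case (const c)
  show ?case by (rule exI[of _ "[:c:]"]) simp
next
  case (coord c)
  then show ?case
    by (intro exI[of _ "[:c x, c y - c x:]"]) (simp add: coordinates_line_point)
next
  case (add f g)
  then obtain P Q where "\<forall>s. f (line_point x y s) = poly P s" "\<forall>s. g (line_point x y s) = poly Q s"
    by auto
  then show ?case by (intro exI[of _ "P + Q"]) simp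
next
  case (mult f g)
  then obtain P Q where "\<forall>s. f (line_point x y s) = poly P s" "\<forall>s. g (line_point x y s) = poly Q s"
    by auto
  then show ?case by (intro exI[of _ "P * Q"]) simp
qed

lemma basic_open_mult: "basic_open (\<lambda>x. f x * g x) = basic_open f \<inter> basic_open g"
  by (auto simp: basic_open_def)

text \<open>Two points of the variety lie on a line contained in it, so irreducibility reduces to the
  fact that a non-zero polynomial in one variable has finitely many roots.\<close>

lemma dense_basic_open_Int:
  fixes U V :: "'n::finite point set"
  assumes "dense_basic_open U" "dense_basic_open V"
  shows "dense_basic_open (U \<inter> V)"
proof -
  obtain f g where f: "polyfun f" "U = basic_open f" and g: "polyfun g" "V = basic_open g"
    using assms by (auto simp: dense_basic_open_def)
  obtain x y where x: "x \<in> U" and y: "y \<in> V"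
    using assms by (auto simp: dense_basic_open_def)
  obtain P where P: "\<And>s. f (line_point x y s) = poly P s"
    using polyfun_line_point[OF f(1)] by blast
  obtain Q where Q: "\<And>s. g (line_point x y s) = poly Q s"
    using polyfun_line_point[OF g(1)] by blast
  \<comment> \<open>The line is at \<open>x\<close> for \<open>s = 0\<close> and at \<open>y\<close>
    for \<open>s = 1\<close>, so neither one-variable polynomial is zero.\<close>
  have "poly P 0 \<noteq> 0" "poly Q 1 \<noteq> 0"
    using x y f g by (auto simp: basic_open_def line_point_0 line_point_1 simp flip: P Q)
  then have "P * Q \<noteq> 0" by auto
  then have "finite {s. poly (P * Q) s = 0}" by (rule poly_roots_finite)
  moreover have "infinite (UNIV :: complex set)" by (rule infinite_UNIV_char_0)
  ultimately obtain s where s: "poly (P * Q) s \<noteq> 0"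
    by (metis (mono_tags, lifting) UNIV_I finite_subset mem_Collect_eq subsetI)
  have "line_point x y s \<in> U \<inter> V"
    using s x y f g by (auto simp: basic_open_def P Q line_point_variety)
  moreover have "U \<inter> V = basic_open (\<lambda>x. f x * g x)"
    by (simp add: basic_open_mult f g)
  ultimately show ?thesis
    unfolding dense_basic_open_def using polyfun.mult[OF f(1) g(1)] by blast
qed

section \<open>Composition of birational maps\<close>

lemma rational_map_dom: "rational_map \<phi> \<Longrightarrow> dense_basic_open (dom \<phi>)"
  by (auto simp: rational_map_def dense_basic_open_def)

lemma rational_map_variety: "rational_map \<phi> \<Longrightarrow> \<phi> x = Some y \<Longrightarrow> y \<in> variety"
  unfolding rational_map_def by (blast intro: ranI)

lemma rational_map_the_variety: "rational_map \<phi> \<Longrightarrow> x \<in> dom \<phi> \<Longrightarrow> the (\<phi> x) \<in> variety"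
  by (metis domD option.sel rational_map_variety)

lemma generically_eq_refl: "dense_basic_open (dom \<phi>) \<Longrightarrow> generically_eq \<phi> \<phi>"
  by (auto simp: generically_eq_def)

lemma generically_eq_sym: "generically_eq \<phi> \<psi> \<Longrightarrow> generically_eq \<psi> \<phi>"
  unfolding generically_eq_def by metis

text \<open>Chaining two agreements needs their open sets to meet, which is irreducibility of the
  variety.\<close>

lemma generically_eq_trans:
  assumes "generically_eq \<phi> \<psi>" "generically_eq \<psi> \<eta>"
  shows "generically_eq \<phi> \<eta>"
proof -
  obtain U V where "dense_basic_open U" "U \<subseteq> dom \<phi>" "\<forall>x\<in>U. \<phi> x = \<psi> x"
    "dense_basic_open V" "V \<subseteq> dom \<eta>" "\<forall>x\<in>V. \<psi> x = \<eta> x"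
    using assms by (auto simp: generically_eq_def)
  then show ?thesis
    unfolding generically_eq_def by (intro exI[of _ "U \<inter> V"]) (auto simp: dense_basic_open_Int)
qed

text \<open>Sums and products of fractions over powers of \<open>g\<close> are again such fractions;
  the exponent grows with the degree of \<open>f\<close>, hence the existential
  \<open>k\<close>.\<close>

lemma rational_map_pullback:
  assumes f: "polyfun f"
    and c: "\<And>c. c \<in> coordinates \<Longrightarrow> \<exists>h. polyfun h \<and> (\<forall>x\<in>D. c (the (\<phi> x)) = h x / g x)"
    and g: "polyfun g" "\<And>x. x \<in> D \<Longrightarrow> g x \<noteq> 0"
  shows "\<exists>h k. polyfun h \<and> (\<forall>x\<in>D. f (the (\<phi> x)) = h x / g x ^ k)"
  using f
proof (induction rule: polyfun.induct)
  case (const a)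
  show ?case by (rule exI[of _ "\<lambda>x. a"], rule exI[of _ 0]) (auto intro: polyfun.const)
next
  case (coord a)
  then obtain h where "polyfun h" "\<forall>x\<in>D. a (the (\<phi> x)) = h x / g x"
    using c by blast
  then show ?case by (intro exI[of _ h] exI[of _ 1]) simp
next
  case (add f1 f2)
  then obtain h1 k1 h2 k2 where h: "polyfun h1" "polyfun h2"
    "\<forall>x\<in>D. f1 (the (\<phi> x)) = h1 x / g x ^ k1"
    "\<forall>x\<in>D. f2 (the (\<phi> x)) = h2 x / g x ^ k2"
    by blast
  show ?case
  proof (intro exI conjI ballI)
    show "polyfun (\<lambda>x. h1 x * g x ^ k2 + h2 x * g x ^ k1)"
      using h g by (intro polyfun.add polyfun.mult polyfun_power)
    fix x assume "x \<in> D"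
    then show "f1 (the (\<phi> x)) + f2 (the (\<phi> x)) =
        (h1 x * g x ^ k2 + h2 x * g x ^ k1) / g x ^ (k1 + k2)"
      using g(2) by (simp add: h power_add divide_simps)
  qed
next
  case (mult f1 f2)
  then obtain h1 k1 h2 k2 where h: "polyfun h1" "polyfun h2"
    "\<forall>x\<in>D. f1 (the (\<phi> x)) = h1 x / g x ^ k1"
    "\<forall>x\<in>D. f2 (the (\<phi> x)) = h2 x / g x ^ k2"
    by blast
  show ?case
  proof (intro exI conjI ballI)
    show "polyfun (\<lambda>x. h1 x * h2 x)"
      using h by (intro polyfun.mult)
    fix x assume "x \<in> D"
    then show "f1 (the (\<phi> x)) * f2 (the (\<phi> x)) = (h1 x * h2 x) / g x ^ (k1 + k2)"
      by (simp add: h power_add)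
  qed
qed

lemma rational_map_denominator:
  assumes "rational_map \<phi>"
  obtains g where "polyfun g" "dom \<phi> = basic_open g" "\<And>x. x \<in> dom \<phi> \<Longrightarrow> g x \<noteq> 0"
    "\<And>f. polyfun f \<Longrightarrow> \<exists>h k. polyfun h \<and> (\<forall>x\<in>dom \<phi>. f (the (\<phi> x)) = h x / g x ^ k)"
proof -
  obtain g where g: "polyfun g" "dom \<phi> = basic_open g"
    and c: "\<And>c. c \<in> coordinates \<Longrightarrow> \<exists>h. polyfun h \<and> (\<forall>x\<in>dom \<phi>. c (the (\<phi> x)) = h x / g x)"
    using assms unfolding rational_map_def by blast
  have nz: "g x \<noteq> 0" if "x \<in> dom \<phi>" for x
    using that unfolding g(2) by (simp add: basic_open_def)
  show thesis
  proof (rule that[OF g nz])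
    fix f :: "'a point \<Rightarrow> complex"
    assume "polyfun f"
    then show "\<exists>h k. polyfun h \<and> (\<forall>x\<in>dom \<phi>. f (the (\<phi> x)) = h x / g x ^ k)"
      by (rule rational_map_pullback[where D = "dom \<phi>" and \<phi> = \<phi> and g = g, OF _ c g(1) nz])
  qed
qed

text \<open>On \<open>dom \<phi>\<close> the pulled-back \<open>f\<close> vanishes where its
  numerator \<open>h\<close> does, so \<open>g * h\<close> cuts out the preimage. The result may be
  empty; \<open>dense_preimage\<close> excludes this for birational maps and dense sets.\<close>

lemma preimage_basic_open:
  assumes "rational_map \<phi>" "polyfun f"
  shows "\<exists>f'. polyfun f' \<and> {x \<in> dom \<phi>. the (\<phi> x) \<in> basic_open f} = basic_open f'"
proof -
  obtain g where g: "polyfun g" "dom \<phi> = basic_open g" "\<And>x. x \<in> dom \<phi> \<Longrightarrow> g x \<noteq> 0"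
    "\<exists>h k. polyfun h \<and> (\<forall>x\<in>dom \<phi>. f (the (\<phi> x)) = h x / g x ^ k)"
    using rational_map_denominator[OF assms(1)] assms(2) by metis
  then obtain h k where h: "polyfun h" "\<And>x. x \<in> dom \<phi> \<Longrightarrow> f (the (\<phi> x)) = h x / g x ^ k"
    by blast
  have "the (\<phi> x) \<in> basic_open f \<longleftrightarrow> h x \<noteq> 0" if x: "x \<in> dom \<phi>" for x
    using rational_map_the_variety[OF assms(1) x] g(3)[OF x] by (simp add: basic_open_def h(2)[OF x])
  then have "{x \<in> dom \<phi>. the (\<phi> x) \<in> basic_open f} = {x \<in> dom \<phi>. h x \<noteq> 0}"
    by blast
  also have "\<dots> = basic_open (\<lambda>x. g x * h x)"
    unfolding g(2) by (auto simp: basic_open_def)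
  finally show ?thesis using polyfun.mult[OF g(1) h(1)] by blast
qed

lemma dom_map_comp: "dom (\<phi> \<circ>\<^sub>m \<psi>) = {x \<in> dom \<psi>. the (\<psi> x) \<in> dom \<phi>}"
  by (auto simp: map_comp_def dom_def split: option.splits)

lemma map_comp_eq: "x \<in> dom \<psi> \<Longrightarrow> (\<phi> \<circ>\<^sub>m \<psi>) x = \<phi> (the (\<psi> x))"
  by (auto simp: map_comp_def)

lemma map_comp_assoc': "(\<phi> \<circ>\<^sub>m \<psi>) \<circ>\<^sub>m \<eta> = \<phi> \<circ>\<^sub>m (\<psi> \<circ>\<^sub>m \<eta>)"
  by (auto simp: map_comp_def fun_eq_iff split: option.splits)

lemma identity_map_comp: "rational_map \<phi> \<Longrightarrow> identity_map \<circ>\<^sub>m \<phi> = \<phi>"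
  by (auto simp: map_comp_def fun_eq_iff identity_map_def rational_map_variety split: option.splits)

text \<open>\<open>rational_map\<close> asks for one denominator shared by all coordinates, which exists since there
  are only finitely many of them.\<close>

lemma rational_map_comp:
  fixes \<phi> \<psi> :: "'n::finite point \<rightharpoonup> 'n point"
  assumes \<phi>: "rational_map \<phi>" and \<psi>: "rational_map \<psi>" and ne: "dom (\<phi> \<circ>\<^sub>m \<psi>) \<noteq> {}"
  shows "rational_map (\<phi> \<circ>\<^sub>m \<psi>)"
proof -
  obtain a where a: "polyfun a" "dom \<phi> = basic_open a"
    and ac: "\<And>c. c \<in> coordinates \<Longrightarrow> \<exists>h. polyfun h \<and> (\<forall>x\<in>dom \<phi>. c (the (\<phi> x)) = h x / a x)"
    using \<phi> unfolding rational_map_def by blast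
  obtain g where g: "polyfun g" "dom \<psi> = basic_open g" "\<And>x. x \<in> dom \<psi> \<Longrightarrow> g x \<noteq> 0"
    and pull: "\<And>f. polyfun f \<Longrightarrow> \<exists>h k. polyfun h \<and> (\<forall>x\<in>dom \<psi>. f (the (\<psi> x)) = h x / g x ^ k)"
    using rational_map_denominator[OF \<psi>] by metis
  obtain b l where b: "polyfun b" "\<And>x. x \<in> dom \<psi> \<Longrightarrow> a (the (\<psi> x)) = b x / g x ^ l"
    using pull[OF a(1)] by blast
  have dom: "dom (\<phi> \<circ>\<^sub>m \<psi>) = {x \<in> dom \<psi>. b x \<noteq> 0}"
  proof -
    have "the (\<psi> x) \<in> dom \<phi> \<longleftrightarrow> b x \<noteq> 0" if x: "x \<in> dom \<psi>" for x
      using rational_map_the_variety[OF \<psi> x] g(3)[OF x]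
      by (simp add: a(2) basic_open_def b(2)[OF x])
    then show ?thesis unfolding dom_map_comp by blast
  qed
  have "\<exists>h k. polyfun h \<and> (\<forall>x\<in>dom (\<phi> \<circ>\<^sub>m \<psi>). c (the ((\<phi> \<circ>\<^sub>m \<psi>) x)) = h x / (b x * g x ^ k))"
    if c: "c \<in> coordinates" for c
  proof -
    obtain h where h: "polyfun h" "\<And>x. x \<in> dom \<phi> \<Longrightarrow> c (the (\<phi> x)) = h x / a x"
      using ac[OF c] by blast
    obtain h' k where h': "polyfun h'" "\<And>x. x \<in> dom \<psi> \<Longrightarrow> h (the (\<psi> x)) = h' x / g x ^ k"
      using pull[OF h(1)] by blast
    \<comment> \<open>The denominator \<open>a\<close> pulls back to \<open>b / g^l\<close>, so
      inverting it moves \<open>g^l\<close> into the numerator.\<close>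
    have "c (the ((\<phi> \<circ>\<^sub>m \<psi>) x)) = (h' x * g x ^ l) / (b x * g x ^ k)" if x: "x \<in> dom (\<phi> \<circ>\<^sub>m \<psi>)" for x
    proof -
      have x1: "x \<in> dom \<psi>" and x2: "the (\<psi> x) \<in> dom \<phi>"
        using x by (auto simp: dom_map_comp)
      then show ?thesis
        using g(3)[OF x1] by (simp add: map_comp_eq h(2)[OF x2] h'(2)[OF x1] b(2)[OF x1])
    qed
    then show ?thesis
      using polyfun.mult[OF h'(1) polyfun_power[OF g(1)]] by blast
  qed
  then obtain N K where N: "\<And>c. c \<in> coordinates \<Longrightarrow> polyfun (N c)"
    "\<And>c x. c \<in> coordinates \<Longrightarrow> x \<in> dom (\<phi> \<circ>\<^sub>m \<psi>) \<Longrightarrow>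
       c (the ((\<phi> \<circ>\<^sub>m \<psi>) x)) = N c x / (b x * g x ^ K c)"
    by metis
  \<comment> \<open>The sum bounds every exponent. \<open>Suc\<close> keeps \<open>M\<close>
    positive, so that the common denominator vanishes wherever \<open>g\<close> does and the domain
    is described exactly.\<close>
  define M where "M = Suc (\<Sum>c\<in>coordinates. K c)"
  have KM: "K c \<le> M" if "c \<in> coordinates" for c
    using member_le_sum[OF that _ finite_coordinates, of K] by (simp add: M_def le_SucI)
  show ?thesis
    unfolding rational_map_def
  proof (intro conjI exI[of _ "\<lambda>x. b x * g x ^ M"])
    show "ran (\<phi> \<circ>\<^sub>m \<psi>) \<subseteq> variety"
      using rational_map_variety[OF \<phi>] by (auto simp: ran_def map_comp_def split: option.splits)
    show "polyfun (\<lambda>x. b x * g x ^ M)"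
      by (intro polyfun.mult polyfun_power b g)
    show "dom (\<phi> \<circ>\<^sub>m \<psi>) = basic_open (\<lambda>x. b x * g x ^ M)"
      unfolding dom g(2) by (auto simp: basic_open_def M_def)
    have "\<exists>h. polyfun h \<and>
        (\<forall>x\<in>dom (\<phi> \<circ>\<^sub>m \<psi>). c (the ((\<phi> \<circ>\<^sub>m \<psi>) x)) = h x / (b x * g x ^ M))"
      if c: "c \<in> coordinates" for c
    proof (intro exI conjI ballI)
      show "polyfun (\<lambda>x. N c x * g x ^ (M - K c))"
        by (intro polyfun.mult polyfun_power N c g)
      fix x assume x: "x \<in> dom (\<phi> \<circ>\<^sub>m \<psi>)"
      then have gx: "g x \<noteq> 0" using g(3) by (auto simp: dom)
      have "g x ^ M = g x ^ (M - K c) * g x ^ K c"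
        using KM[OF c] by (simp flip: power_add)
      with gx show "c (the ((\<phi> \<circ>\<^sub>m \<psi>) x)) = N c x * g x ^ (M - K c) / (b x * g x ^ M)"
        by (simp add: N(2)[OF c x])
    qed
    then show "\<forall>c\<in>coordinates. \<exists>h. polyfun h \<and>
        (\<forall>x\<in>dom (\<phi> \<circ>\<^sub>m \<psi>). c (the ((\<phi> \<circ>\<^sub>m \<psi>) x)) = h x / (b x * g x ^ M))"
      by blast
    show "dom (\<phi> \<circ>\<^sub>m \<psi>) \<noteq> {}" by (rule ne)
  qed
qed

lemma birational_map_rational: "birational_map \<phi> \<Longrightarrow> rational_map \<phi>"
  by (simp add: birational_map_def)

lemma birational_map_inverse:
  assumes "birational_map \<phi>"
  obtains \<psi> where "birational_map \<psi>" "generically_eq (\<psi> \<circ>\<^sub>m \<phi>) identity_map"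
    "generically_eq (\<phi> \<circ>\<^sub>m \<psi>) identity_map"
  using assms unfolding birational_map_def by blast

text \<open>A birational map has dense image: on a dense open set \<open>V\<close> the generic
  inverse provides preimages, and \<open>V\<close> meets \<open>U\<close>. For a constant rational
  map the preimage could be empty.\<close>

lemma dense_preimage:
  assumes "birational_map \<phi>" "dense_basic_open U"
  shows "dense_basic_open {x \<in> dom \<phi>. the (\<phi> x) \<in> U}"
proof -
  obtain \<psi> V where V: "dense_basic_open V" "V \<subseteq> dom (\<phi> \<circ>\<^sub>m \<psi>)" "\<forall>x\<in>V. (\<phi> \<circ>\<^sub>m \<psi>) x = identity_map x"
    using assms(1) by (auto simp: birational_map_def generically_eq_def)
  obtain y where y: "y \<in> V" "y \<in> U"
    using dense_basic_open_Int[OF V(1) assms(2)] by (auto simp: dense_basic_open_def)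
  have "y \<in> variety" using y(1) V(1) by (auto simp: dense_basic_open_def basic_open_def)
  then have "(\<phi> \<circ>\<^sub>m \<psi>) y = Some y" using V(3) y(1) by (simp add: identity_map_def)
  then obtain x where "\<phi> x = Some y" by (auto simp: map_comp_def split: option.splits)
  then have "x \<in> {x \<in> dom \<phi>. the (\<phi> x) \<in> U}" using y by (simp add: domI)
  moreover obtain f where f: "polyfun f" "U = basic_open f"
    using assms(2) by (auto simp: dense_basic_open_def)
  ultimately show ?thesis
    using preimage_basic_open[OF birational_map_rational[OF assms(1)] f(1)]
    unfolding dense_basic_open_def f(2) by blast
qed

lemma generically_eq_comp_right:
  assumes "generically_eq \<phi> \<phi>'" "birational_map \<psi>"
  shows "generically_eq (\<phi> \<circ>\<^sub>m \<psi>) (\<phi>' \<circ>\<^sub>m \<psi>)"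
proof -
  obtain U where U: "dense_basic_open U" "U \<subseteq> dom \<phi>" "U \<subseteq> dom \<phi>'" "\<forall>x\<in>U. \<phi> x = \<phi>' x"
    using assms(1) by (auto simp: generically_eq_def)
  show ?thesis
    unfolding generically_eq_def using U(2-)
    by (intro exI[of _ "{x \<in> dom \<psi>. the (\<psi> x) \<in> U}"] conjI dense_preimage[OF assms(2) U(1)])
       (auto simp: dom_map_comp map_comp_eq)
qed

text \<open>Agreement of the inner maps passes to the composites wherever the first composite is
  defined; that domain is dense because it is a preimage under the birational
  \<open>\<psi>\<close>.\<close>

lemma generically_eq_comp_left:
  assumes "generically_eq \<psi> \<psi>'" "rational_map \<phi>" "birational_map \<psi>"
  shows "generically_eq (\<phi> \<circ>\<^sub>m \<psi>) (\<phi> \<circ>\<^sub>m \<psi>')"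
proof -
  obtain U where U: "dense_basic_open U" "U \<subseteq> dom \<psi>" "U \<subseteq> dom \<psi>'" "\<forall>x\<in>U. \<psi> x = \<psi>' x"
    using assms(1) by (auto simp: generically_eq_def)
  show ?thesis
    unfolding generically_eq_def
  proof (intro exI conjI)
    show "dense_basic_open (U \<inter> dom (\<phi> \<circ>\<^sub>m \<psi>))"
      unfolding dom_map_comp
      by (intro dense_basic_open_Int U dense_preimage assms rational_map_dom)
    show "U \<inter> dom (\<phi> \<circ>\<^sub>m \<psi>) \<subseteq> dom (\<phi> \<circ>\<^sub>m \<psi>')"
      using U(3,4) by (auto simp: dom_map_comp)
    show "\<forall>x\<in>U \<inter> dom (\<phi> \<circ>\<^sub>m \<psi>). (\<phi> \<circ>\<^sub>m \<psi>) x = (\<phi> \<circ>\<^sub>m \<psi>') x"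
      using U(4) by (auto simp: map_comp_def)
  qed simp
qed

lemma rational_map_birational_comp:
  assumes "rational_map \<phi>" "birational_map \<psi>"
  shows "rational_map (\<phi> \<circ>\<^sub>m \<psi>)"
proof (rule rational_map_comp)
  show "dom (\<phi> \<circ>\<^sub>m \<psi>) \<noteq> {}"
    using dense_preimage[OF assms(2) rational_map_dom[OF assms(1)]]
    by (simp add: dom_map_comp dense_basic_open_def)
qed (rule assms(1) birational_map_rational[OF assms(2)])+

text \<open>The inner pair cancels first, since \<open>\<phi>' \<circ>\<^sub>m \<phi>\<close> acts
  as the identity between \<open>\<psi>'\<close> and \<open>\<psi>\<close>. Exchanging the roles of
  maps and inverses yields the other side.\<close>

lemma inverse_comp_generically_eq:
  assumes "birational_map \<phi>" "birational_map \<psi>" "birational_map \<psi>'"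
    "generically_eq (\<phi>' \<circ>\<^sub>m \<phi>) identity_map" "generically_eq (\<psi>' \<circ>\<^sub>m \<psi>) identity_map"
  shows "generically_eq ((\<psi>' \<circ>\<^sub>m \<phi>') \<circ>\<^sub>m (\<phi> \<circ>\<^sub>m \<psi>)) identity_map"
proof -
  have "generically_eq (identity_map \<circ>\<^sub>m \<psi>) ((\<phi>' \<circ>\<^sub>m \<phi>) \<circ>\<^sub>m \<psi>)"
    by (intro generically_eq_comp_right generically_eq_sym[OF assms(4)] assms(2))
  then have "generically_eq \<psi> ((\<phi>' \<circ>\<^sub>m \<phi>) \<circ>\<^sub>m \<psi>)"
    by (simp add: identity_map_comp assms birational_map_rational)
  then have "generically_eq (\<psi>' \<circ>\<^sub>m \<psi>) (\<psi>' \<circ>\<^sub>m ((\<phi>' \<circ>\<^sub>m \<phi>) \<circ>\<^sub>m \<psi>))"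
    by (rule generically_eq_comp_left) (rule birational_map_rational[OF assms(3)] assms(2))+
  then have "generically_eq (\<psi>' \<circ>\<^sub>m ((\<phi>' \<circ>\<^sub>m \<phi>) \<circ>\<^sub>m \<psi>)) identity_map"
    using assms(5) by (rule generically_eq_trans[OF generically_eq_sym])
  then show ?thesis by (simp add: map_comp_assoc')
qed

lemma birational_map_comp:
  assumes "birational_map \<phi>" "birational_map \<psi>"
  shows "birational_map (\<phi> \<circ>\<^sub>m \<psi>)"
proof -
  obtain \<phi>' where \<phi>': "birational_map \<phi>'" "generically_eq (\<phi>' \<circ>\<^sub>m \<phi>) identity_map"
    "generically_eq (\<phi> \<circ>\<^sub>m \<phi>') identity_map"
    using birational_map_inverse[OF assms(1)] .
  obtain \<psi>' where \<psi>': "birational_map \<psi>'" "generically_eq (\<psi>' \<circ>\<^sub>m \<psi>) identity_map"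
    "generically_eq (\<psi> \<circ>\<^sub>m \<psi>') identity_map"
    using birational_map_inverse[OF assms(2)] .
  note rat = rational_map_birational_comp[OF birational_map_rational]
  show ?thesis
    unfolding birational_map_def
    using rat[OF assms] rat[OF \<psi>'(1) \<phi>'(1)]
      inverse_comp_generically_eq[OF assms \<psi>'(1) \<phi>'(2) \<psi>'(2)]
      inverse_comp_generically_eq[OF \<psi>'(1) \<phi>'(1) assms(1) \<psi>'(3) \<phi>'(3)]
    by blast
qed

lemma rational_map_identity: "rational_map (identity_map :: 'n::finite point \<rightharpoonup> 'n point)"
proof -
  have "((0, 0, 0), (1, 0)) \<in> (variety :: 'n point set)"
    by (simp add: variety_def params_def)
  then have "dom (identity_map :: 'n point \<rightharpoonup> 'n point) \<noteq> {}"
    unfolding identity_map_def by simp blast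
  moreover have "ran (identity_map :: 'n point \<rightharpoonup> 'n point) \<subseteq> variety"
    by (auto simp: identity_map_def ran_def restrict_map_def split: if_splits)
  moreover have "dom (identity_map :: 'n point \<rightharpoonup> 'n point) = basic_open (\<lambda>x. 1)"
    by (simp add: identity_map_def basic_open_def)
  moreover have "\<exists>h. polyfun h \<and> (\<forall>x\<in>dom identity_map. c (the (identity_map x)) = h x / 1)"
    if "c \<in> coordinates" for c :: "'n point \<Rightarrow> complex"
    using that by (intro exI[of _ c]) (auto simp: identity_map_def polyfun.coord)
  ultimately show ?thesis
    unfolding rational_map_def by (intro conjI exI[of _ "\<lambda>x. 1"] polyfun.const) simp_all
qed

lemma birational_map_identity: "birational_map identity_map"
  unfolding birational_map_def
  by (intro conjI exI[of _ identity_map] rational_map_identity)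
     (simp_all add: identity_map_comp generically_eq_refl rational_map_dom rational_map_identity)

section \<open>The group of birational maps\<close>

lemma birational_class_eq_iff:
  assumes "birational_map \<phi>" "birational_map \<psi>"
  shows "birational_class \<phi> = birational_class \<psi> \<longleftrightarrow> generically_eq \<phi> \<psi>"
proof
  assume "birational_class \<phi> = birational_class \<psi>"
  moreover have "\<psi> \<in> birational_class \<psi>"
    using assms by (simp add: birational_class_def generically_eq_refl rational_map_dom birational_map_rational)
  ultimately have "\<psi> \<in> birational_class \<phi>" by blast
  then show "generically_eq \<phi> \<psi>" by (simp add: birational_class_def)
next
  assume eq: "generically_eq \<phi> \<psi>"
  have "generically_eq \<phi> \<eta> \<longleftrightarrow> generically_eq \<psi> \<eta>" for \<eta>
    using generically_eq_trans[OF eq] generically_eq_trans[OF generically_eq_sym[OF eq]] by blast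
  then show "birational_class \<phi> = birational_class \<psi>"
    by (simp add: birational_class_def)
qed

text \<open>Every pair of representatives contributes the same class to the union, because
  composition respects generic equality in each argument; the union is non-empty since
  \<open>\<phi>\<close> and \<open>\<psi>\<close> lie in their own classes.\<close>

lemma birational_group_mult:
  assumes "birational_map \<phi>" "birational_map \<psi>"
  shows "birational_class \<phi> \<otimes>\<^bsub>birational_group\<^esub> birational_class \<psi> = birational_class (\<phi> \<circ>\<^sub>m \<psi>)"
proof -
  have self: "\<phi> \<in> birational_class \<phi>" "\<psi> \<in> birational_class \<psi>"
    using assms by (simp_all add: birational_class_def generically_eq_refl rational_map_dom birational_map_rational)
  have "birational_class (\<phi>' \<circ>\<^sub>m \<psi>') = birational_class (\<phi> \<circ>\<^sub>m \<psi>)"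
    if "\<phi>' \<in> birational_class \<phi>" "\<psi>' \<in> birational_class \<psi>" for \<phi>' \<psi>'
  proof -
    have \<phi>': "birational_map \<phi>'" "generically_eq \<phi> \<phi>'" and \<psi>': "birational_map \<psi>'" "generically_eq \<psi> \<psi>'"
      using that by (auto simp: birational_class_def)
    have "generically_eq (\<phi>' \<circ>\<^sub>m \<psi>') (\<phi> \<circ>\<^sub>m \<psi>')"
      by (intro generically_eq_comp_right generically_eq_sym[OF \<phi>'(2)] \<psi>'(1))
    moreover have "generically_eq (\<phi> \<circ>\<^sub>m \<psi>') (\<phi> \<circ>\<^sub>m \<psi>)"
      by (intro generically_eq_comp_left generically_eq_sym[OF \<psi>'(2)] \<psi>'(1) birational_map_rational assms)
    ultimately have "generically_eq (\<phi>' \<circ>\<^sub>m \<psi>') (\<phi> \<circ>\<^sub>m \<psi>)"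
      by (rule generically_eq_trans)
    then show ?thesis
      by (simp add: birational_class_eq_iff birational_map_comp \<phi>' \<psi>' assms)
  qed
  then have "(\<Union>\<phi>'\<in>birational_class \<phi>. \<Union>\<psi>'\<in>birational_class \<psi>. birational_class (\<phi>' \<circ>\<^sub>m \<psi>')) =
      (\<Union>\<phi>'\<in>birational_class \<phi>. \<Union>\<psi>'\<in>birational_class \<psi>. birational_class (\<phi> \<circ>\<^sub>m \<psi>))"
    by (intro SUP_cong HOL.refl) auto
  also have "\<dots> = birational_class (\<phi> \<circ>\<^sub>m \<psi>)"
    using self by auto
  finally show ?thesis by (simp add: birational_group_def)
qed

lemma birational_group_one: "\<one>\<^bsub>birational_group\<^esub> = birational_class identity_map"
  by (simp add: birational_group_def)

lemma birational_group_carrier: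
  "a \<in> carrier birational_group \<longleftrightarrow> (\<exists>\<phi>. birational_map \<phi> \<and> a = birational_class \<phi>)"
  by (auto simp: birational_group_def)

lemma group_birational_group:
  "group (birational_group :: ('n::finite point \<rightharpoonup> 'n point) set monoid)"
proof (rule groupI)
  fix x y z :: "('n point \<rightharpoonup> 'n point) set"
  assume "x \<in> carrier birational_group" "y \<in> carrier birational_group" "z \<in> carrier birational_group"
  then show "x \<otimes>\<^bsub>birational_group\<^esub> y \<otimes>\<^bsub>birational_group\<^esub> z =
      x \<otimes>\<^bsub>birational_group\<^esub> (y \<otimes>\<^bsub>birational_group\<^esub> z)"
    by (auto simp: birational_group_carrier birational_group_mult birational_map_comp map_comp_assoc')
next
  fix x :: "('n point \<rightharpoonup> 'n point) set"
  assume "x \<in> carrier birational_group"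
  then obtain \<phi> where \<phi>: "birational_map \<phi>" "x = birational_class \<phi>"
    by (auto simp: birational_group_carrier)
  show "\<one>\<^bsub>birational_group\<^esub> \<otimes>\<^bsub>birational_group\<^esub> x = x"
    by (simp add: \<phi> birational_group_one birational_group_mult birational_map_identity
        identity_map_comp birational_map_rational)
  obtain \<psi> where \<psi>: "birational_map \<psi>" "generically_eq (\<psi> \<circ>\<^sub>m \<phi>) identity_map"
    using birational_map_inverse[OF \<phi>(1)] .
  then have "birational_class \<psi> \<otimes>\<^bsub>birational_group\<^esub> x = \<one>\<^bsub>birational_group\<^esub>"
    by (simp add: \<phi> birational_group_one birational_group_mult birational_map_identity
        birational_map_comp birational_class_eq_iff)
  then show "\<exists>y\<in>carrier birational_group. y \<otimes>\<^bsub>birational_group\<^esub> x = \<one>\<^bsub>birational_group\<^esub>"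
    using \<psi>(1) by (intro bexI[of _ "birational_class \<psi>"]) (auto simp: birational_group_carrier)
next
  fix x y :: "('n point \<rightharpoonup> 'n point) set"
  assume "x \<in> carrier birational_group" "y \<in> carrier birational_group"
  then obtain \<phi> \<psi> where "birational_map \<phi>" "x = birational_class \<phi>"
    "birational_map \<psi>" "y = birational_class \<psi>"
    by (auto simp: birational_group_carrier)
  then show "x \<otimes>\<^bsub>birational_group\<^esub> y \<in> carrier birational_group"
    unfolding birational_group_carrier
    by (intro exI[of _ "\<phi> \<circ>\<^sub>m \<psi>"]) (simp add: birational_group_mult birational_map_comp)
next
  show "\<one>\<^bsub>birational_group\<^esub> \<in> carrier (birational_group :: ('n point \<rightharpoonup> 'n point) set monoid)"
    unfolding birational_group_carrier birational_group_one
    using birational_map_identity by (intro exI[of _ identity_map]) simp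
qed

section \<open>The infinite dihedral group\<close>

lemma word_eq_append:
  "word_eq u v \<Longrightarrow> word_eq (a @ u @ b) (a @ v @ b)"
proof (induction rule: word_eq.induct)
  case (cancel u s v)
  show ?case using word_eq.cancel[of "a @ u" s "v @ b"] by simp
qed (rule word_eq.refl | erule word_eq.sym | erule (1) word_eq.trans)+

lemma word_eq_append2:
  assumes "word_eq u u'" "word_eq v v'"
  shows "word_eq (u @ v) (u' @ v')"
proof (rule word_eq.trans)
  show "word_eq (u @ v) (u' @ v)" using word_eq_append[OF assms(1), of "[]" v] by simp
  show "word_eq (u' @ v) (u' @ v')" using word_eq_append[OF assms(2), of u' "[]"] by simp
qed

lemma word_class_eq_iff: "word_class u = word_class v \<longleftrightarrow> word_eq u v"
proof
  assume "word_class u = word_class v"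
  moreover have "v \<in> word_class v" by (simp add: word_class_def word_eq.refl)
  ultimately have "v \<in> word_class u" by simp
  then show "word_eq u v" by (simp add: word_class_def)
next
  assume "word_eq u v"
  then have "word_eq u w \<longleftrightarrow> word_eq v w" for w
    using word_eq.trans[of u v w] word_eq.trans[OF word_eq.sym[of u v], of w] by blast
  then show "word_class u = word_class v" by (simp add: word_class_def)
qed

lemma word_class_self: "u \<in> word_class u"
  by (simp add: word_class_def word_eq.refl)

lemma affine_weyl_A1_mult:
  "word_class u \<otimes>\<^bsub>affine_weyl_A1\<^esub> word_class v = word_class (u @ v)"
proof -
  have "word_class (u' @ v') = word_class (u @ v)"
    if "u' \<in> word_class u" "v' \<in> word_class v" for u' v'
    unfolding word_class_eq_iff using that
    by (intro word_eq.sym[OF word_eq_append2]) (simp_all add: word_class_def)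
  then have "(\<Union>u'\<in>word_class u. \<Union>v'\<in>word_class v. word_class (u' @ v')) =
      (\<Union>u'\<in>word_class u. \<Union>v'\<in>word_class v. word_class (u @ v))"
    by (intro SUP_cong HOL.refl) auto
  also have "\<dots> = word_class (u @ v)"
    using word_class_self by auto
  finally show ?thesis by (simp add: affine_weyl_A1_def)
qed

lemma swap_refl_swap_refl [simp]: "swap_refl (swap_refl s) = s"
  by (cases s) auto

lemma word_eq_map_swap: "word_eq u v \<Longrightarrow> word_eq (map swap_refl u) (map swap_refl v)"
proof (induction rule: word_eq.induct)
  case (cancel u s v)
  show ?case using word_eq.cancel[of "map swap_refl u" "swap_refl s" "map swap_refl v"] by simp
qed (rule word_eq.refl | erule word_eq.sym | erule (1) word_eq.trans)+

lemma map_swap_word_class: "map swap_refl ` word_class u = word_class (map swap_refl u)"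
proof
  show "map swap_refl ` word_class u \<subseteq> word_class (map swap_refl u)"
    by (auto simp: word_class_def word_eq_map_swap)
  show "word_class (map swap_refl u) \<subseteq> map swap_refl ` word_class u"
  proof
    fix v assume "v \<in> word_class (map swap_refl u)"
    then have "map swap_refl v \<in> word_class u"
      using word_eq_map_swap[of "map swap_refl u" v] by (simp add: word_class_def comp_def)
    then show "v \<in> map swap_refl ` word_class u"
      by (intro image_eqI[of _ _ "map swap_refl v"]) (simp_all add: comp_def)
  qed
qed

text \<open>\<open>word_act w = (e, k)\<close> records the action \<open>\<alpha>\<^sub>1 \<mapsto> e\<alpha>\<^sub>1 + 2k\<close> of a word, where
  \<open>S0\<close> is \<open>\<alpha>\<^sub>1 \<mapsto> 2 - \<alpha>\<^sub>1\<close> and \<open>S1\<close> is \<open>\<alpha>\<^sub>1 \<mapsto> -\<alpha>\<^sub>1\<close>.\<close>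

fun word_act :: "simple_refl list \<Rightarrow> int \<times> int" where
  "word_act [] = (1, 0)"
| "word_act (S0 # w) = (- fst (word_act w), 1 - snd (word_act w))"
| "word_act (S1 # w) = (- fst (word_act w), - snd (word_act w))"

lemma word_act_Cons_cong: "word_act u = word_act v \<Longrightarrow> word_act (s # u) = word_act (s # v)"
  by (cases s) auto

lemma word_act_word_eq: "word_eq u v \<Longrightarrow> word_act u = word_act v"
proof (induction rule: word_eq.induct)
  case (cancel u s v)
  have "word_act ([s, s] @ v) = word_act v" by (cases s) auto
  then show ?case by (induction u) (auto intro: word_act_Cons_cong)
qed auto

text \<open>The reduced words of the infinite dihedral group. For length zero both letters give the
  empty word, which is why \<open>alt_word_inj\<close> recovers the word and not the pair
  \<open>(s, n)\<close>.\<close>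

fun alt_word :: "simple_refl \<Rightarrow> nat \<Rightarrow> simple_refl list" where
  "alt_word s 0 = []"
| "alt_word s (Suc n) = s # alt_word (swap_refl s) n"

text \<open>A letter put in front either extends the alternation or cancels against the first
  letter, and in both cases the result alternates again.\<close>

lemma word_eq_alt_word: "\<exists>s n. word_eq w (alt_word s n)"
proof (induction w)
  case Nil
  show ?case by (rule exI, rule exI[of _ 0]) (simp add: word_eq.refl)
next
  case (Cons t w)
  then obtain s n where "word_eq w (alt_word s n)" by blast
  then have eq: "word_eq (t # w) (t # alt_word s n)"
    using word_eq_append[of w _ "[t]" "[]"] by simp
  show ?case
  proof (cases n)
    case 0
    then have "t # alt_word s n = alt_word t 1" by simp
    with eq show ?thesis by metis
  next
    case (Suc m)
    show ?thesis
    proof (cases "t = s")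
      case True
      then have "word_eq (t # alt_word s n) (alt_word (swap_refl s) m)"
        using word_eq.cancel[of "[]" s "alt_word (swap_refl s) m"] Suc by simp
      with eq have "word_eq (t # w) (alt_word (swap_refl s) m)" by (rule word_eq.trans)
      then show ?thesis by blast
    next
      case False
      then have "swap_refl t = s" by (cases s; cases t) auto
      then have "t # alt_word s n = alt_word t (Suc n)" by simp
      with eq show ?thesis by metis
    qed
  qed
qed

text \<open>Every letter reverses the sign, and two consecutive letters form a translation:
  \<open>S0 S1\<close> raises \<open>k\<close> by one, \<open>S1 S0\<close> lowers it. Both formulas
  are proved together because removing the first letter changes the starting one.\<close>

lemma word_act_alt_word:
  "word_act (alt_word S0 n) = ((-1) ^ n, (int n + 1) div 2)"
  "word_act (alt_word S1 n) = ((-1) ^ n, - (int n div 2))"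
proof (induction n)
  case (Suc n)
  have "1 + int n div 2 = (int (Suc n) + 1) div 2" by presburger
  then show "word_act (alt_word S0 (Suc n)) = ((-1) ^ Suc n, (int (Suc n) + 1) div 2)"
    by (simp add: Suc)
  show "word_act (alt_word S1 (Suc n)) = ((-1) ^ Suc n, - (int (Suc n) div 2))"
    by (simp add: Suc algebra_simps)
qed auto

lemma minus_one_power_eq_iff: "(-1 :: int) ^ m = (-1) ^ n \<longleftrightarrow> even m = even n"
  by (cases "even m"; cases "even n") auto

text \<open>The sign fixes the parity of the length. With equal first letters the translation then
  gives the length; with different ones the translations have opposite directions, so both vanish,
  and parity excludes the one-letter word \<open>[S1]\<close>.\<close>

lemma alt_word_inj:
  assumes "word_act (alt_word s m) = word_act (alt_word t n)"
  shows "alt_word s m = alt_word t n"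
proof -
  have e: "even m = even n"
    using assms by (cases s; cases t) (auto simp: word_act_alt_word minus_one_power_eq_iff)
  show ?thesis
  proof (cases "s = t")
    case True
    then have "(int m + 1) div 2 = (int n + 1) div 2 \<or> int m div 2 = int n div 2"
      using assms by (cases s) (auto simp: word_act_alt_word)
    with e have "m = n" by (cases "even m") (auto elim!: evenE oddE)
    with True show ?thesis by simp
  next
    case False
    then have "(int m + 1) div 2 = - (int n div 2) \<or> - (int m div 2) = (int n + 1) div 2"
      using assms by (cases s; cases t) (auto simp: word_act_alt_word)
    with e have "m = 0 \<and> n = 0" by (cases "even m") (auto elim!: evenE oddE)
    then show ?thesis by simp
  qed
qed

text \<open>Both words are reduced to alternating form, where the action already separates them;
  thus the affine maps satisfy no relations beyond the defining ones.\<close>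

lemma word_eq_iff_word_act: "word_eq u v \<longleftrightarrow> word_act u = word_act v"
proof
  assume act: "word_act u = word_act v"
  obtain s m where u: "word_eq u (alt_word s m)" using word_eq_alt_word by blast
  obtain t n where v: "word_eq v (alt_word t n)" using word_eq_alt_word by blast
  have "alt_word s m = alt_word t n"
    using act word_act_word_eq[OF u] word_act_word_eq[OF v] by (intro alt_word_inj) simp
  with u have "word_eq u (alt_word t n)" by simp
  then show "word_eq u v" using word_eq.sym[OF v] by (rule word_eq.trans)
qed (rule word_act_word_eq)

lemma word_act_fst: "fst (word_act w) = 1 \<or> fst (word_act w) = -1"
  by (induction w rule: word_act.induct) auto

section \<open>Words evaluated in a group\<close>

primrec word_prod :: "('a, 'b) monoid_scheme \<Rightarrow> (simple_refl \<Rightarrow> 'a) \<Rightarrow> simple_refl list \<Rightarrow> 'a" where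
  "word_prod G g [] = \<one>\<^bsub>G\<^esub>"
| "word_prod G g (x # w) = g x \<otimes>\<^bsub>G\<^esub> word_prod G g w"

context group
begin

lemma word_prod_closed: "(\<And>x. g x \<in> carrier G) \<Longrightarrow> word_prod G g w \<in> carrier G"
  by (induction w) auto

lemma word_prod_append:
  "(\<And>x. g x \<in> carrier G) \<Longrightarrow> word_prod G g (u @ v) = word_prod G g u \<otimes> word_prod G g v"
  by (induction u) (auto simp: word_prod_closed m_assoc)

lemma word_prod_word_eq:
  assumes g: "\<And>x. g x \<in> carrier G" "\<And>x. g x \<otimes> g x = \<one>" and "word_eq u v"
  shows "word_prod G g u = word_prod G g v"
  using assms(3)
proof (induction rule: word_eq.induct)
  case (cancel u s v)
  have "word_prod G g ([s, s] @ v) = word_prod G g v"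
    using g word_prod_closed[of g v] by (simp flip: m_assoc)
  then show ?case using g(1) by (simp add: word_prod_append)
qed auto

text \<open>The group-theoretic content, separated from the birational maps: for two involutions
  \<open>s\<close> and \<open>r\<close>, everything except injectivity is formal. The factor
  \<open>\<rho> c\<close> stands on the right because \<open>(c, a)\<close> in the semidirect
  product means \<open>a\<close> times the element of \<open>C\<^sub>2\<close>.\<close>

lemma iso_C2_ltimes_affine_weyl_A1:
  assumes s: "s \<in> carrier G" "s \<otimes> s = \<one>" and r: "r \<in> carrier G" "r \<otimes> r = \<one>"
  defines "g \<equiv> case_simple_refl (r \<otimes> s \<otimes> inv r) s"
  defines "\<rho> \<equiv> \<lambda>c :: int. if c = 0 then \<one> else r"
  assumes faithful: "\<And>u v c d. c \<in> {0, 1} \<Longrightarrow> d \<in> {0, 1} \<Longrightarrow>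
    word_prod G g u \<otimes> \<rho> c = word_prod G g v \<otimes> \<rho> d \<Longrightarrow> c = d \<and> word_eq u v"
  shows "\<exists>\<Phi> \<in> iso C2_ltimes_affine_weyl_A1 (subgroup_generated G {s, r}).
    \<Phi> (0, word_class [S0]) = r \<otimes> s \<otimes> inv r \<and>
    \<Phi> (0, word_class [S1]) = s \<and> \<Phi> (1, word_class []) = r"
proof -
  have inv_r: "inv r = r" using r by (intro inv_equality) auto
  have inv_s: "inv s = s" using s by (intro inv_equality) auto
  have rr: "r \<otimes> (r \<otimes> x) = x" if "x \<in> carrier G" for x
    using that r by (simp flip: m_assoc)
  have ss: "s \<otimes> (s \<otimes> x) = x" if "x \<in> carrier G" for x
    using that s by (simp flip: m_assoc)
  have g: "g x \<in> carrier G" "g x \<otimes> g x = \<one>" for x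
    using s r by (cases x; simp add: g_def inv_r m_assoc rr ss)+
  \<comment> \<open>Conjugation by \<open>r\<close> exchanges the two letters and thereby realises
    \<open>swap_action\<close> inside \<open>G\<close>.\<close>
  have conj_g: "g (swap_refl x) = r \<otimes> g x \<otimes> r" for x
    using s r by (cases x) (simp_all add: g_def inv_r m_assoc rr)
  note closed = word_prod_closed[of g, OF g(1)]
  have conj: "word_prod G g (map swap_refl w) = r \<otimes> word_prod G g w \<otimes> r" for w
    using r by (induction w) (simp_all add: conj_g m_assoc closed g(1) rr)
  have \<rho>: "\<rho> c \<in> carrier G" for c
    using r by (simp add: \<rho>_def)
  \<comment> \<open>Any representative of the class may be chosen, since the value depends only on
    the class by \<open>word_prod_word_eq\<close>.\<close>
  define \<Phi> where "\<Phi> = (\<lambda>(c, a). word_prod G g (SOME w. w \<in> a) \<otimes> \<rho> c)"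
  have \<Phi>: "\<Phi> (c, word_class w) = word_prod G g w \<otimes> \<rho> c" for c w
  proof -
    have "(SOME v. v \<in> word_class w) \<in> word_class w"
      using word_class_self by (rule someI)
    then have "word_eq w (SOME v. v \<in> word_class w)"
      by (simp add: word_class_def)
    from word_prod_word_eq[OF g this] show ?thesis
      by (simp add: \<Phi>_def)
  qed
  have carrier: "x \<in> carrier C2_ltimes_affine_weyl_A1 \<longleftrightarrow>
      (\<exists>c\<in>{0, 1}. \<exists>w. x = (c, word_class w))" for x
    by (cases x) (auto simp: C2_ltimes_affine_weyl_A1_def semidirect_product_def
        carrier_integer_mod_group affine_weyl_A1_def)
  have mult: "(c, word_class u) \<otimes>\<^bsub>C2_ltimes_affine_weyl_A1\<^esub> (d, word_class v) =
      ((c + d) mod 2, word_class (u @ (if c = 0 then v else map swap_refl v)))" for c d u v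
    by (simp add: C2_ltimes_affine_weyl_A1_def semidirect_product_def swap_action_def
        map_swap_word_class affine_weyl_A1_mult)
  have \<Phi>_mult: "\<Phi> (x \<otimes>\<^bsub>C2_ltimes_affine_weyl_A1\<^esub> y) = \<Phi> x \<otimes> \<Phi> y"
    if xy: "x \<in> carrier C2_ltimes_affine_weyl_A1" "y \<in> carrier C2_ltimes_affine_weyl_A1" for x y
  proof -
    obtain c u where x: "x = (c, word_class u)" "c \<in> {0, 1}" using xy(1) carrier by blast
    obtain d v where y: "y = (d, word_class v)" "d \<in> {0, 1}" using xy(2) carrier by blast
    show ?thesis
      using x(2) y(2) r
      by (auto simp: x(1) y(1) mult \<Phi> \<rho>_def word_prod_append g(1) conj m_assoc closed rr)
  qed
  \<comment> \<open>The image of \<open>\<Phi>\<close> contains the generators and is closed under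
    products; inverses of generators are covered because \<open>s\<close> and \<open>r\<close> are
    involutions.\<close>
  have gen: "generate G {s, r} = \<Phi> ` carrier C2_ltimes_affine_weyl_A1" (is "?L = ?R")
  proof
    have im: "word_prod G g w \<otimes> \<rho> c \<in> ?R" if "c \<in> {0, 1}" for w c
      using that carrier \<Phi> by (metis image_eqI)
    have "\<one> \<in> ?R" using im[of 0 "[]"] by (simp add: \<rho>_def)
    have "s \<in> ?R" using im[of 0 "[S1]"] s by (simp add: \<rho>_def g_def)
    have "r \<in> ?R" using im[of 1 "[]"] r by (simp add: \<rho>_def)
    have closed_R: "x \<otimes> y \<in> ?R" if xy: "x \<in> ?R" "y \<in> ?R" for x y
    proof -
      obtain x' y' where x': "x = \<Phi> x'" "x' \<in> carrier C2_ltimes_affine_weyl_A1"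
        and y': "y = \<Phi> y'" "y' \<in> carrier C2_ltimes_affine_weyl_A1"
        using xy by blast
      obtain c u where cu: "x' = (c, word_class u)" "c \<in> {0, 1}" using x'(2) carrier by blast
      obtain d v where dv: "y' = (d, word_class v)" "d \<in> {0, 1}" using y'(2) carrier by blast
      have "x' \<otimes>\<^bsub>C2_ltimes_affine_weyl_A1\<^esub> y' \<in> carrier C2_ltimes_affine_weyl_A1"
        unfolding cu(1) dv(1) mult carrier using cu(2) dv(2) by auto
      then show ?thesis using \<Phi>_mult[OF x'(2) y'(2)] x'(1) y'(1) by (metis image_eqI)
    qed
    show "?L \<subseteq> ?R"
    proof
      fix x assume "x \<in> ?L"
      then show "x \<in> ?R"
        by (induction rule: generate.induct)
           (use \<open>\<one> \<in> ?R\<close> \<open>s \<in> ?R\<close> \<open>r \<in> ?R\<close> inv_r inv_s closed_R in auto)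
    qed
    have s_L: "s \<in> ?L" and r_L: "r \<in> ?L" by (auto intro: generate.incl)
    have "r \<otimes> s \<otimes> inv r \<in> ?L"
      unfolding inv_r by (intro generate.eng s_L r_L)
    with s_L have "g x \<in> ?L" for x by (cases x) (simp_all add: g_def)
    then have "word_prod G g w \<in> ?L" for w
      by (induction w) (auto intro: generate.one generate.eng)
    moreover have "\<rho> c \<in> ?L" for c
      using r_L by (simp add: \<rho>_def generate.one)
    ultimately show "?R \<subseteq> ?L"
      using carrier \<Phi> by (auto intro!: generate.eng)
  qed
  have carrier_gen: "carrier (subgroup_generated G {s, r}) = generate G {s, r}"
    using s r by (simp add: carrier_subgroup_generated Int_absorb1)
  have "inj_on \<Phi> (carrier C2_ltimes_affine_weyl_A1)"
  proof (rule inj_onI)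
    fix x y
    assume xy: "x \<in> carrier C2_ltimes_affine_weyl_A1" "y \<in> carrier C2_ltimes_affine_weyl_A1"
      and eq: "\<Phi> x = \<Phi> y"
    obtain c u where x: "x = (c, word_class u)" "c \<in> {0, 1}" using xy(1) carrier by blast
    obtain d v where y: "y = (d, word_class v)" "d \<in> {0, 1}" using xy(2) carrier by blast
    show "x = y"
      using faithful[OF x(2) y(2), of u v] eq by (simp add: x(1) y(1) \<Phi> word_class_eq_iff)
  qed
  then have "bij_betw \<Phi> (carrier C2_ltimes_affine_weyl_A1) (carrier (subgroup_generated G {s, r}))"
    by (simp add: bij_betw_def carrier_gen gen)
  moreover have "\<Phi> \<in> hom C2_ltimes_affine_weyl_A1 (subgroup_generated G {s, r})"
    by (rule homI) (auto simp: carrier_gen gen \<Phi>_mult)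
  ultimately have "\<Phi> \<in> iso C2_ltimes_affine_weyl_A1 (subgroup_generated G {s, r})"
    by (simp add: iso_def)
  moreover have "\<Phi> (0, word_class [S0]) = r \<otimes> s \<otimes> inv r" "\<Phi> (0, word_class [S1]) = s"
    "\<Phi> (1, word_class []) = r"
    using s r by (simp_all add: \<Phi> \<rho>_def g_def)
  ultimately show ?thesis by blast
qed

end

section \<open>Rationality of the generators\<close>

text \<open>Clearing denominators in the formulas turns each coordinate into an equation with a
  polynomial right-hand side, so matrices never have to be divided by a scalar.\<close>

lemma rational_mapI:
  fixes \<phi> :: "'n::finite point \<rightharpoonup> 'n point"
  assumes dom: "dom \<phi> = basic_open g" "polyfun g" "basic_open g \<noteq> {}"
    and ran: "\<And>x. x \<in> dom \<phi> \<Longrightarrow> the (\<phi> x) \<in> variety"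
    and num: "polymat P" "polymat Q" "polyfun T" "polyfun A" "polyfun B"
    and eq: "\<And>x. x \<in> dom \<phi> \<Longrightarrow> \<exists>p q t a b. the (\<phi> x) = ((p, q, t), (a, b)) \<and>
      mat (g x) ** p = P x \<and> mat (g x) ** q = Q x \<and> g x * t = T x \<and> g x * a = A x \<and> g x * b = B x"
  shows "rational_map \<phi>"
  unfolding rational_map_def
proof (intro conjI exI[of _ g])
  show "dom \<phi> \<noteq> {}" using dom by simp
  show "ran \<phi> \<subseteq> variety"
  proof
    fix y assume "y \<in> ran \<phi>"
    then obtain x where "\<phi> x = Some y" unfolding ran_def by blast
    then show "y \<in> variety" using ran[of x] by (simp add: domI)
  qed
  have nz: "g x \<noteq> 0" if "x \<in> dom \<phi>" for x
    using that unfolding dom by (simp add: basic_open_def)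
  have entries: "g x * fst (fst (the (\<phi> x))) $ i $ j = P x $ i $ j"
      "g x * fst (snd (fst (the (\<phi> x)))) $ i $ j = Q x $ i $ j"
      "g x * snd (snd (fst (the (\<phi> x)))) = T x"
      "g x * fst (snd (the (\<phi> x))) = A x" "g x * snd (snd (the (\<phi> x))) = B x"
    if x: "x \<in> dom \<phi>" for x i j
  proof -
    obtain p q t a b where y: "the (\<phi> x) = ((p, q, t), (a, b))"
      "mat (g x) ** p = P x" "mat (g x) ** q = Q x" "g x * t = T x" "g x * a = A x" "g x * b = B x"
      using eq[OF x] by blast
    then show "g x * fst (fst (the (\<phi> x))) $ i $ j = P x $ i $ j"
      "g x * fst (snd (fst (the (\<phi> x)))) $ i $ j = Q x $ i $ j"
      "g x * snd (snd (fst (the (\<phi> x)))) = T x"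
      "g x * fst (snd (the (\<phi> x))) = A x" "g x * snd (snd (the (\<phi> x))) = B x"
      by (simp_all flip: mat_mul_nth)
  qed
  show "\<forall>c\<in>coordinates. \<exists>h. polyfun h \<and> (\<forall>x\<in>dom \<phi>. c (the (\<phi> x)) = h x / g x)"
  proof
    fix c :: "'n point \<Rightarrow> complex" assume "c \<in> coordinates"
    then consider i j where "c = (\<lambda>x. fst (fst x) $ i $ j)" | i j where "c = (\<lambda>x. fst (snd (fst x)) $ i $ j)"
      | "c = (\<lambda>x. snd (snd (fst x)))" | "c = (\<lambda>x. fst (snd x))" | "c = (\<lambda>x. snd (snd x))"
      unfolding coordinates_eq by auto
    then have "\<exists>h. polyfun h \<and> (\<forall>x\<in>dom \<phi>. g x * c (the (\<phi> x)) = h x)"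
    proof cases
      case (1 i j)
      then show ?thesis using entries(1) num(1)
        by (intro exI[of _ "\<lambda>x. P x $ i $ j"]) (simp add: polymat_def)
    next
      case (2 i j)
      then show ?thesis using entries(2) num(2)
        by (intro exI[of _ "\<lambda>x. Q x $ i $ j"]) (simp add: polymat_def)
    next
      case 3
      then show ?thesis using entries(3) num(3) by (intro exI[of _ T]) simp
    next
      case 4
      then show ?thesis using entries(4) num(4) by (intro exI[of _ A]) simp
    next
      case 5
      then show ?thesis using entries(5) num(5) by (intro exI[of _ B]) simp
    qed
    then obtain h where h: "polyfun h" "\<And>x. x \<in> dom \<phi> \<Longrightarrow> g x * c (the (\<phi> x)) = h x"
      by blast
    have "c (the (\<phi> x)) = h x / g x" if x: "x \<in> dom \<phi>" for x
      using h(2)[OF x] nz[OF x] by (simp add: eq_divide_eq mult.commute)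
    with h(1) show "\<exists>h. polyfun h \<and> (\<forall>x\<in>dom \<phi>. c (the (\<phi> x)) = h x / g x)" by blast
  qed
qed (rule dom)+

text \<open>Such a map sends its domain into itself, so the whole domain serves as the open set of
  agreement.\<close>

lemma involution_generically_eq:
  fixes \<phi> :: "'n::finite point \<rightharpoonup> 'n point"
  assumes "rational_map \<phi>" "\<And>x. x \<in> dom \<phi> \<Longrightarrow> \<phi> (the (\<phi> x)) = Some x"
  shows "generically_eq (\<phi> \<circ>\<^sub>m \<phi>) identity_map"
  unfolding generically_eq_def
proof (intro exI conjI ballI)
  have variety: "x \<in> variety" if "x \<in> dom \<phi>" for x
    using rational_map_dom[OF assms(1)] that by (auto simp only: dense_basic_open_def basic_open_def)
  show "dense_basic_open (dom \<phi>)" by (rule rational_map_dom[OF assms(1)])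
  have "the (\<phi> x) \<in> dom \<phi>" if "x \<in> dom \<phi>" for x
    using assms(2)[OF that] by (rule domI)
  then show "dom \<phi> \<subseteq> dom (\<phi> \<circ>\<^sub>m \<phi>)" unfolding dom_map_comp by blast
  have "dom identity_map = (variety :: 'n point set)" by (simp add: identity_map_def)
  then show "dom \<phi> \<subseteq> dom identity_map" using variety by blast
  fix x assume x: "x \<in> dom \<phi>"
  show "(\<phi> \<circ>\<^sub>m \<phi>) x = identity_map x"
    using variety[OF x] by (simp add: map_comp_eq[OF x] assms(2)[OF x] identity_map_def)
qed

lemma birational_map_involution:
  assumes "rational_map \<phi>" "\<And>x. x \<in> dom \<phi> \<Longrightarrow> \<phi> (the (\<phi> x)) = Some x"
  shows "birational_map \<phi>"
  using involution_generically_eq[OF assms] assms(1) unfolding birational_map_def by blast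

section \<open>Polynomial data for \<open>s\<^sub>1\<close>\<close>

definition point_f :: "'n::finite point \<Rightarrow> 'n cmat" where
  "point_f x = PII_f (fst (fst x)) (fst (snd (fst x))) (snd (snd (fst x)))"

lemma polymat_coordinates:
  "polymat (\<lambda>x. fst (fst x))" "polymat (\<lambda>x. fst (snd (fst x)))"
  by (simp_all add: polymat_def polyfun_coordinates)

lemma polymat_point_f: "polymat (point_f :: 'n::finite point \<Rightarrow> 'n cmat)"
proof -
  have "polyfun (\<lambda>x :: 'n point. snd (snd (fst x)) / 2)"
    using polyfun.mult[OF polyfun_coordinates(3) polyfun.const[of "1/2"]] by simp
  then show ?thesis
    unfolding point_f_def PII_f_def
    by (intro polymat_add polymat_mul polymat_mat polymat_coordinates)
qed

text \<open>The classical adjugate, given by Cramer's determinants rather than cofactors so that it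
  matches \<open>matrix_inv_nth\<close> and is visibly polynomial in the entries.\<close>

definition adjugate :: "'a::field^'n^'n \<Rightarrow> 'a^'n^'n" where
  "adjugate A = (\<chi> k l. det (\<chi> i j. if j = k then mat 1 $ i $ l else A $ i $ j))"

lemma mat_det_mul_matrix_inv:
  fixes A :: "'a::field^'n^'n"
  assumes "invertible A"
  shows "mat (det A) ** matrix_inv A = adjugate A"
  using assms by (simp add: vec_eq_iff mat_mul_nth matrix_inv_nth adjugate_def invertible_det_nz)

lemma polymat_adjugate:
  assumes "polymat F"
  shows "polymat (\<lambda>x. adjugate (F x))"
  unfolding polymat_def adjugate_def
proof (intro allI)
  fix k l
  have "polyfun (\<lambda>x. (\<chi> i j. if j = k then mat 1 $ i $ l else F x $ i $ j) $ i $ j)" for i j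
    using assms by (cases "j = k") (simp_all add: polymat_def polyfun.const)
  then have "polyfun (\<lambda>x. det (\<chi> i j. if j = k then mat 1 $ i $ l else F x $ i $ j))"
    by (intro polyfun_det) (simp add: polymat_def)
  then show "polyfun (\<lambda>x. (\<chi> k l. det (\<chi> i j. if j = k then mat 1 $ i $ l else F x $ i $ j)) $ k $ l)"
    by simp
qed

lemma s1_extended_eq:
  fixes p q :: "'n::finite cmat" and t :: complex and \<alpha> :: param
  defines "f \<equiv> PII_f p q t"
  defines "Q \<equiv> q + mat (snd \<alpha>) ** matrix_inv f"
  shows "extended_map s1_phase s1_param ((p, q, t), \<alpha>) =
    (if \<alpha> \<in> params \<and> invertible f then Some ((f - Q ** Q - mat (t/2), Q, t), s1_param \<alpha>) else None)"
  using s1_phase_eq[of p q t \<alpha>] s1_phase_None[of p q t \<alpha>]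
  unfolding extended_map_def Q_def f_def by (simp del: s1_phase.simps)

text \<open>The new \<open>p\<close> contains \<open>f\<^sup>-\<^sup>2\<close>, hence a squared
  determinant as common denominator; squaring leaves the non-vanishing set unchanged.\<close>

lemma s1_extended_dom:
  "dom (extended_map (s1_phase :: param \<Rightarrow> 'n::finite ext_phase \<rightharpoonup> 'n ext_phase) s1_param) =
    basic_open (\<lambda>x. det (point_f x) ^ 2)"
proof (rule Set.set_eqI)
  fix x :: "'n point"
  obtain p q t \<alpha> where x: "x = ((p, q, t), \<alpha>)" by (metis surj_pair)
  show "x \<in> dom (extended_map s1_phase s1_param) \<longleftrightarrow> x \<in> basic_open (\<lambda>x. det (point_f x) ^ 2)"
    by (simp add: domIff s1_extended_eq x basic_open_def variety_def point_f_def invertible_det_nz)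
qed

text \<open>The first application preserves \<open>f\<close> and reverses the sign of
  \<open>\<alpha>\<^sub>1\<close>, so the second subtracts from \<open>q\<close> what the first
  added; \<open>p\<close> is then recovered from \<open>f\<close> and \<open>q\<close>.\<close>

lemma s1_extended_involution:
  fixes x :: "'n::finite point"
  assumes "x \<in> dom (extended_map s1_phase s1_param)"
  shows "extended_map s1_phase s1_param (the (extended_map s1_phase s1_param x)) = Some x"
proof -
  obtain p q t \<alpha> where x: "x = ((p, q, t), \<alpha>)" by (metis surj_pair)
  define f where "f = PII_f p q t"
  define Q where "Q = q + mat (snd \<alpha>) ** matrix_inv f"
  have \<alpha>: "\<alpha> \<in> params" and inv: "invertible f"
    using assms by (auto simp: x domIff s1_extended_eq f_def split: if_splits)
  have s: "snd (s1_param \<alpha>) = - snd \<alpha>" "s1_param (s1_param \<alpha>) = \<alpha>"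
    by (cases \<alpha>; simp)+
  have F: "PII_f (f - Q ** Q - mat (t/2)) Q t = f"
    by (simp add: PII_f_def)
  have "Q + mat (snd (s1_param \<alpha>)) ** matrix_inv f = q"
    by (simp add: Q_def s mat_minus matrix_mul_minus_left)
  moreover have "f - q ** q - mat (t/2) = p"
    by (simp add: f_def PII_f_def)
  ultimately show ?thesis
    using \<alpha> inv s1_param_params[OF \<alpha>]
    by (simp add: x s1_extended_eq s F flip: f_def Q_def)
qed

lemma invertible_mat_1: "invertible (mat 1 :: 'a::semiring_1^'n^'n)"
  unfolding invertible_def by (intro exI[of _ "mat 1"]) simp

lemma birational_s1:
  "birational_map (extended_map (s1_phase :: param \<Rightarrow> 'n::finite ext_phase \<rightharpoonup> 'n ext_phase) s1_param)"
proof (rule birational_map_involution)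
  let ?\<phi> = "extended_map (s1_phase :: param \<Rightarrow> 'n ext_phase \<rightharpoonup> 'n ext_phase) s1_param"
  define d where "d = (\<lambda>x :: 'n point. det (point_f x))"
  \<comment> \<open>\<open>R\<close> is the numerator of the new \<open>q\<close> over
    \<open>det f\<close>. Over the squared determinant, the numerator of the new \<open>p\<close> is
    therefore \<open>(det f)^2 (f - t/2) - R^2\<close>.\<close>
  define R where "R = (\<lambda>x :: 'n point. mat (d x) ** fst (snd (fst x)) +
    mat (snd (snd x)) ** adjugate (point_f x))"
  have d: "polyfun d" unfolding d_def by (rule polyfun_det[OF polymat_point_f])
  have R: "polymat R"
    unfolding R_def
    by (intro polymat_add polymat_mul polymat_mat d polyfun_coordinates polymat_coordinates
        polymat_adjugate polymat_point_f)
  have t2: "polyfun (\<lambda>x :: 'n point. snd (snd (fst x)) / 2)"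
    using polyfun.mult[OF polyfun_coordinates(3) polyfun.const[of "1/2"]] by simp
  show "rational_map ?\<phi>"
  proof (rule rational_mapI[where g = "\<lambda>x. d x ^ 2"
        and P = "\<lambda>x. mat (d x ^ 2) ** (point_f x - mat (snd (snd (fst x)) / 2)) - R x ** R x"
        and Q = "\<lambda>x. mat (d x) ** R x" and T = "\<lambda>x. d x ^ 2 * snd (snd (fst x))"
        and A = "\<lambda>x. d x ^ 2 * (fst (snd x) + 2 * snd (snd x))"
        and B = "\<lambda>x. d x ^ 2 * (- snd (snd x))"])
    show "dom ?\<phi> = basic_open (\<lambda>x. d x ^ 2)" by (simp add: s1_extended_dom d_def)
    \<comment> \<open>At \<open>p = 1\<close>, \<open>q = 0\<close>, \<open>t = 0\<close> the matrix
      \<open>f\<close> is the identity.\<close>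
    have "((mat 1, 0, 0), (1, 0)) \<in> basic_open (\<lambda>x :: 'n point. d x ^ 2)"
      using invertible_mat_1[where 'a = complex and 'n = 'n]
      by (simp add: basic_open_def variety_def params_def d_def point_f_def PII_f_def invertible_det_nz)
    then show "basic_open (\<lambda>x :: 'n point. d x ^ 2) \<noteq> {}" by blast
    fix x assume x_dom: "x \<in> dom ?\<phi>"
    obtain p q t \<alpha>0 \<alpha>1 where x: "x = ((p, q, t), (\<alpha>0, \<alpha>1))" by (metis surj_pair)
    define f where "f = PII_f p q t"
    define Q where "Q = q + mat \<alpha>1 ** matrix_inv f"
    have \<alpha>: "(\<alpha>0, \<alpha>1) \<in> params" and inv: "invertible f"
      using x_dom by (auto simp: x domIff s1_extended_eq f_def split: if_splits)
    have val: "the (?\<phi> x) = ((f - Q ** Q - mat (t/2), Q, t), (\<alpha>0 + 2 * \<alpha>1, - \<alpha>1))"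
      using \<alpha> inv by (simp add: x s1_extended_eq flip: f_def Q_def)
    then show "the (?\<phi> x) \<in> variety"
      using s1_param_params[OF \<alpha>] by (simp add: variety_def)
    have dx: "d x = det f" "point_f x = f" by (simp_all add: d_def point_f_def x f_def)
    have R_eq: "R x = mat (d x) ** Q"
      unfolding R_def dx Q_def mat_det_mul_matrix_inv[OF inv, symmetric]
      by (simp add: x matrix_ring_simps mult.commute)
    have x_coords: "snd (snd (fst x)) = t" "fst (snd x) = \<alpha>0" "snd (snd x) = \<alpha>1"
      by (simp_all add: x)
    show "\<exists>p q t a b. the (?\<phi> x) = ((p, q, t), (a, b)) \<and>
      mat (d x ^ 2) ** p = mat (d x ^ 2) ** (point_f x - mat (snd (snd (fst x)) / 2)) - R x ** R x \<and>
      mat (d x ^ 2) ** q = mat (d x) ** R x \<and> d x ^ 2 * t = d x ^ 2 * snd (snd (fst x)) \<and>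
      d x ^ 2 * a = d x ^ 2 * (fst (snd x) + 2 * snd (snd x)) \<and>
      d x ^ 2 * b = d x ^ 2 * (- snd (snd x))"
    proof (intro exI conjI)
      show "mat (d x ^ 2) ** (f - Q ** Q - mat (t/2)) =
          mat (d x ^ 2) ** (point_f x - mat (snd (snd (fst x)) / 2)) - R x ** R x"
        by (simp add: R_eq dx(2) x_coords matrix_ring_simps power2_eq_square)
      show "mat (d x ^ 2) ** Q = mat (d x) ** R x"
        by (simp add: R_eq matrix_ring_simps power2_eq_square)
      show "the (?\<phi> x) = ((f - Q ** Q - mat (t/2), Q, t), (\<alpha>0 + 2 * \<alpha>1, - \<alpha>1))"
        by (rule val)
    qed (simp_all add: x_coords)
  qed (intro polymat_diff polymat_mul polymat_mat polyfun_power polyfun.mult polyfun.add polyfun_minus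
      polyfun.const polyfun_coordinates d R polymat_point_f t2)+
qed (rule s1_extended_involution)

lemma r_extended_eq:
  "extended_map r_phase r_param ((p, q, t), \<alpha>) =
    (if \<alpha> \<in> params then Some ((- p, - q, t), r_param \<alpha>) else None)"
  by (simp add: extended_map_def)

lemma r_extended_involution:
  fixes x :: "'n::finite point"
  assumes "x \<in> dom (extended_map r_phase r_param)"
  shows "extended_map r_phase r_param (the (extended_map r_phase r_param x)) = Some x"
proof -
  obtain p q t \<alpha>0 \<alpha>1 where x: "x = ((p, q, t), (\<alpha>0, \<alpha>1))" by (metis surj_pair)
  have \<alpha>: "(\<alpha>0, \<alpha>1) \<in> params"
    using assms by (auto simp: x domIff r_extended_eq split: if_splits)
  show ?thesis
    using \<alpha> r_param_params[OF \<alpha>] by (simp add: x r_extended_eq)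
qed

lemma birational_r:
  "birational_map (extended_map (r_phase :: param \<Rightarrow> 'n::finite ext_phase \<rightharpoonup> 'n ext_phase) r_param)"
proof (rule birational_map_involution)
  let ?\<phi> = "extended_map (r_phase :: param \<Rightarrow> 'n ext_phase \<rightharpoonup> 'n ext_phase) r_param"
  show "rational_map ?\<phi>"
  proof (rule rational_mapI[where g = "\<lambda>x. 1"
        and P = "\<lambda>x. mat (-1) ** fst (fst x)" and Q = "\<lambda>x. mat (-1) ** fst (snd (fst x))"
        and T = "\<lambda>x. snd (snd (fst x))" and A = "\<lambda>x. snd (snd x)" and B = "\<lambda>x. fst (snd x)"])
    show "dom ?\<phi> = basic_open (\<lambda>x. 1)"
    proof (rule Set.set_eqI)
      fix x :: "'n point"
      obtain p q t \<alpha> where x: "x = ((p, q, t), \<alpha>)" by (metis surj_pair)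
      show "x \<in> dom ?\<phi> \<longleftrightarrow> x \<in> basic_open (\<lambda>x. 1)"
        by (simp add: domIff r_extended_eq x basic_open_def variety_def)
    qed
    have "((0, 0, 0), (1, 0)) \<in> basic_open (\<lambda>x :: 'n point. 1)"
      by (simp add: basic_open_def variety_def params_def)
    then show "basic_open (\<lambda>x :: 'n point. 1) \<noteq> {}" by blast
    fix x assume x_dom: "x \<in> dom ?\<phi>"
    obtain p q t \<alpha>0 \<alpha>1 where x: "x = ((p, q, t), (\<alpha>0, \<alpha>1))" by (metis surj_pair)
    have \<alpha>: "(\<alpha>0, \<alpha>1) \<in> params"
      using x_dom by (auto simp: x domIff r_extended_eq split: if_splits)
    have val: "the (?\<phi> x) = ((- p, - q, t), (\<alpha>1, \<alpha>0))"
      using \<alpha> by (simp add: x r_extended_eq)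
    then show "the (?\<phi> x) \<in> variety"
      using r_param_params[OF \<alpha>] by (simp add: variety_def)
    show "\<exists>p q t a b. the (?\<phi> x) = ((p, q, t), (a, b)) \<and>
      mat 1 ** p = mat (-1) ** fst (fst x) \<and> mat 1 ** q = mat (-1) ** fst (snd (fst x)) \<and>
      1 * t = snd (snd (fst x)) \<and> 1 * a = snd (snd x) \<and> 1 * b = fst (snd x)"
      unfolding val by (simp add: x mat_minus matrix_mul_minus_left)
  qed (intro polymat_mul polymat_mat polyfun.const polyfun_coordinates polymat_coordinates)+
qed (rule r_extended_involution)

section \<open>The action on the parameter\<close>

text \<open>The condition concerns one representative on its whole domain, so composition needs no
  genericity argument; \<open>acts_on_param_unique\<close> shows that the choice does not affect
  \<open>(e, m)\<close>.\<close>

definition acts_on_param :: "('n::finite point \<rightharpoonup> 'n point) set \<Rightarrow> int \<Rightarrow> int \<Rightarrow> bool" where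
  "acts_on_param a e m \<longleftrightarrow> (\<exists>\<phi>. birational_map \<phi> \<and> a = birational_class \<phi> \<and>
     (\<forall>x\<in>dom \<phi>. snd (snd (the (\<phi> x))) = of_int e * snd (snd x) + of_int m))"

lemma acts_on_param_mult:
  assumes "acts_on_param a e m" "acts_on_param b e' m'"
  shows "acts_on_param (a \<otimes>\<^bsub>birational_group\<^esub> b) (e * e') (e * m' + m)"
proof -
  obtain \<phi> \<psi> where \<phi>: "birational_map \<phi>" "a = birational_class \<phi>"
      "\<And>x. x \<in> dom \<phi> \<Longrightarrow> snd (snd (the (\<phi> x))) = of_int e * snd (snd x) + of_int m"
    and \<psi>: "birational_map \<psi>" "b = birational_class \<psi>"
      "\<And>x. x \<in> dom \<psi> \<Longrightarrow> snd (snd (the (\<psi> x))) = of_int e' * snd (snd x) + of_int m'"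
    using assms unfolding acts_on_param_def by blast
  show ?thesis
    unfolding acts_on_param_def
  proof (intro exI conjI ballI)
    show "birational_map (\<phi> \<circ>\<^sub>m \<psi>)" by (rule birational_map_comp[OF \<phi>(1) \<psi>(1)])
    show "a \<otimes>\<^bsub>birational_group\<^esub> b = birational_class (\<phi> \<circ>\<^sub>m \<psi>)"
      by (simp add: \<phi> \<psi> birational_group_mult)
    fix x assume "x \<in> dom (\<phi> \<circ>\<^sub>m \<psi>)"
    then have x: "x \<in> dom \<psi>" "the (\<psi> x) \<in> dom \<phi>" unfolding dom_map_comp by simp_all
    show "snd (snd (the ((\<phi> \<circ>\<^sub>m \<psi>) x))) = of_int (e * e') * snd (snd x) + of_int (e * m' + m)"
      by (simp add: map_comp_eq[OF x(1)] \<phi>(3)[OF x(2)] \<psi>(3)[OF x(1)] algebra_simps)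
  qed
qed

text \<open>Distinct affine functions of \<open>\<alpha>\<^sub>1\<close> differ on a non-empty basic
  open set, which must meet the set on which two representatives agree.\<close>

lemma acts_on_param_unique:
  fixes a :: "('n::finite point \<rightharpoonup> 'n point) set"
  assumes "acts_on_param a e m" "acts_on_param a e' m'"
  shows "e = e' \<and> m = m'"
proof (rule ccontr)
  assume neq: "\<not> (e = e' \<and> m = m')"
  obtain \<phi> \<psi> where \<phi>: "birational_map \<phi>" "a = birational_class \<phi>"
      "\<And>x. x \<in> dom \<phi> \<Longrightarrow> snd (snd (the (\<phi> x))) = of_int e * snd (snd x) + of_int m"
    and \<psi>: "birational_map \<psi>" "a = birational_class \<psi>"
      "\<And>x. x \<in> dom \<psi> \<Longrightarrow> snd (snd (the (\<psi> x))) = of_int e' * snd (snd x) + of_int m'"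
    using assms unfolding acts_on_param_def by blast
  have "generically_eq \<phi> \<psi>"
    using \<phi>(1,2) \<psi>(1,2) birational_class_eq_iff by blast
  then obtain U where U: "dense_basic_open U" "U \<subseteq> dom \<phi>" "U \<subseteq> dom \<psi>" "\<forall>x\<in>U. \<phi> x = \<psi> x"
    unfolding generically_eq_def by blast
  let ?h = "\<lambda>x :: 'n point. (of_int e * snd (snd x) + of_int m) - (of_int e' * snd (snd x) + of_int m')"
  have "polyfun ?h"
    by (intro polyfun_diff polyfun.add polyfun.mult polyfun.const polyfun_coordinates)
  \<comment> \<open>If the constants agree, \<open>\<alpha>\<^sub>1 = 1\<close> exposes
    \<open>e - e'\<close>; otherwise \<open>\<alpha>\<^sub>1 = 0\<close> exposes
    \<open>m - m'\<close>.\<close>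
  moreover have "basic_open ?h \<noteq> {}"
  proof (cases "m = m'")
    case True
    then have "((0, 0, 0), (0, 1)) \<in> basic_open ?h"
      using neq by (simp add: basic_open_def variety_def params_def)
    then show ?thesis by blast
  next
    case False
    then have "((0, 0, 0), (1, 0)) \<in> basic_open ?h"
      by (simp add: basic_open_def variety_def params_def)
    then show ?thesis by blast
  qed
  ultimately have "dense_basic_open (basic_open ?h)"
    unfolding dense_basic_open_def by blast
  from dense_basic_open_Int[OF U(1) this]
  obtain x where x: "x \<in> U" "x \<in> basic_open ?h" unfolding dense_basic_open_def by blast
  have "of_int e * snd (snd x) + of_int m = snd (snd (the (\<phi> x)))"
    using \<phi>(3) U(2) x(1) by (simp only: subset_iff)
  also have "\<dots> = snd (snd (the (\<psi> x)))"
    using U(4) x(1) by simp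
  also have "\<dots> = of_int e' * snd (snd x) + of_int m'"
    using \<psi>(3) U(3) x(1) by (simp only: subset_iff)
  finally show False using x(2) by (simp add: basic_open_def)
qed

lemma acts_on_param_one: "acts_on_param \<one>\<^bsub>birational_group\<^esub> 1 0"
  unfolding acts_on_param_def birational_group_one
  by (intro exI[of _ identity_map] conjI birational_map_identity)
     (auto simp: identity_map_def)

lemma acts_on_param_s1: "acts_on_param (s1_transformation :: ('n::finite point \<rightharpoonup> 'n point) set) (-1) 0"
  unfolding acts_on_param_def s1_transformation_def
proof (intro exI conjI ballI)
  fix x :: "'n point"
  assume "x \<in> dom (extended_map s1_phase s1_param)"
  moreover obtain p q t \<alpha>0 \<alpha>1 where x: "x = ((p, q, t), (\<alpha>0, \<alpha>1))" by (metis surj_pair)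
  ultimately show "snd (snd (the (extended_map s1_phase s1_param x))) = of_int (-1) * snd (snd x) + of_int 0"
    by (auto simp: x domIff s1_extended_eq split: if_splits)
qed (simp_all add: birational_s1)

lemma acts_on_param_r: "acts_on_param (r_transformation :: ('n::finite point \<rightharpoonup> 'n point) set) (-1) 1"
  unfolding acts_on_param_def r_transformation_def
proof (intro exI conjI ballI)
  fix x :: "'n point"
  assume dom: "x \<in> dom (extended_map r_phase r_param)"
  obtain p q t \<alpha>0 \<alpha>1 where x: "x = ((p, q, t), (\<alpha>0, \<alpha>1))" by (metis surj_pair)
  have \<alpha>: "(\<alpha>0, \<alpha>1) \<in> params"
    using dom by (auto simp: x domIff r_extended_eq split: if_splits)
  then have "\<alpha>0 = 1 - \<alpha>1" by (simp add: params_def eq_diff_eq)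
  then show "snd (snd (the (extended_map r_phase r_param x))) = of_int (-1) * snd (snd x) + of_int 1"
    using \<alpha> by (simp add: x r_extended_eq)
qed (simp_all add: birational_r)

lemma birational_class_involution:
  assumes "birational_map \<phi>" "\<And>x. x \<in> dom \<phi> \<Longrightarrow> \<phi> (the (\<phi> x)) = Some x"
  shows "birational_class \<phi> \<otimes>\<^bsub>birational_group\<^esub> birational_class \<phi> = \<one>\<^bsub>birational_group\<^esub>"
  using involution_generically_eq[OF birational_map_rational[OF assms(1)] assms(2)]
  by (simp add: birational_group_mult birational_group_one assms(1) birational_class_eq_iff
      birational_map_comp birational_map_identity)

theorem proposition2p1:
  shows "let G = (birational_group :: ('n::finite point \<rightharpoonup> 'n point) set monoid);
             s1 = s1_transformation; r = r_transformation; s0 = r \<otimes>\<^bsub>G\<^esub> s1 \<otimes>\<^bsub>G\<^esub> inv\<^bsub>G\<^esub> r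
         in baecklund_transformation params
              (PII_solutions :: param \<Rightarrow> 'n ext_phase set set) s1_phase s1_param \<and>
            baecklund_transformation params
              (PII_solutions :: param \<Rightarrow> 'n ext_phase set set) r_phase r_param \<and>
            birational_map (extended_map (s1_phase :: param \<Rightarrow> 'n ext_phase \<rightharpoonup> 'n ext_phase) s1_param) \<and>
            birational_map (extended_map (r_phase :: param \<Rightarrow> 'n ext_phase \<rightharpoonup> 'n ext_phase) r_param) \<and>
            (\<exists>\<Phi> \<in> iso C2_ltimes_affine_weyl_A1 (subgroup_generated G {s1, r}).
               \<Phi> (0, word_class [S0]) = s0 \<and>
               \<Phi> (0, word_class [S1]) = s1 \<and>
               \<Phi> (1, word_class []) = r)"
proof -
  let ?G = "birational_group :: ('n point \<rightharpoonup> 'n point) set monoid"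
  let ?s = "s1_transformation :: ('n point \<rightharpoonup> 'n point) set"
  let ?r = "r_transformation :: ('n point \<rightharpoonup> 'n point) set"
  interpret group ?G by (rule group_birational_group)
  have s: "?s \<in> carrier ?G" "?s \<otimes>\<^bsub>?G\<^esub> ?s = \<one>\<^bsub>?G\<^esub>"
    unfolding s1_transformation_def
    using birational_s1 birational_class_involution[OF birational_s1 s1_extended_involution]
    by (auto simp only: birational_group_carrier)
  have r: "?r \<in> carrier ?G" "?r \<otimes>\<^bsub>?G\<^esub> ?r = \<one>\<^bsub>?G\<^esub>"
    unfolding r_transformation_def
    using birational_r birational_class_involution[OF birational_r r_extended_involution]
    by (auto simp only: birational_group_carrier)
  have inv_r: "inv\<^bsub>?G\<^esub> ?r = ?r" using r by (intro inv_equality)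
  let ?g = "case_simple_refl (?r \<otimes>\<^bsub>?G\<^esub> ?s \<otimes>\<^bsub>?G\<^esub> inv\<^bsub>?G\<^esub> ?r) ?s"
  let ?\<rho> = "\<lambda>c :: int. if c = 0 then \<one>\<^bsub>?G\<^esub> else ?r"
  \<comment> \<open>The three factors send \<open>a\<close> to \<open>1 - a\<close>, then to
    \<open>a - 1\<close>, then to \<open>2 - a\<close>.\<close>
  have s0: "acts_on_param (?r \<otimes>\<^bsub>?G\<^esub> ?s \<otimes>\<^bsub>?G\<^esub> inv\<^bsub>?G\<^esub> ?r) (-1) 2"
    using acts_on_param_mult[OF acts_on_param_mult[OF acts_on_param_r acts_on_param_s1] acts_on_param_r]
    by (simp add: inv_r)
  \<comment> \<open>\<open>word_act\<close> records half the translation, whence the factor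
    two.\<close>
  have word: "acts_on_param (word_prod ?G ?g w) (fst (word_act w)) (2 * snd (word_act w))" for w
  proof (induction w)
    case Nil
    show ?case by (simp add: acts_on_param_one)
  next
    case (Cons x w)
    show ?case
      using acts_on_param_mult[OF s0 Cons] acts_on_param_mult[OF acts_on_param_s1 Cons]
      by (cases x) (simp_all add: algebra_simps)
  qed
  \<comment> \<open>One formula for both cases: \<open>c = 0\<close> gives the identity and
    \<open>c = 1\<close> gives \<open>a \<mapsto> 1 - a\<close>.\<close>
  have \<rho>: "acts_on_param (?\<rho> c) (1 - 2 * c) c" if "c \<in> {0, 1}" for c
    using that acts_on_param_one acts_on_param_r by auto
  have faithful: "c = d \<and> word_eq u v"
    if c: "c \<in> {0, 1}" and d: "d \<in> {0, 1}"
      and eq: "word_prod ?G ?g u \<otimes>\<^bsub>?G\<^esub> ?\<rho> c = word_prod ?G ?g v \<otimes>\<^bsub>?G\<^esub> ?\<rho> d" for u v c d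
  proof -
    have "fst (word_act u) * (1 - 2 * c) = fst (word_act v) * (1 - 2 * d) \<and>
        fst (word_act u) * c + 2 * snd (word_act u) = fst (word_act v) * d + 2 * snd (word_act v)"
      using acts_on_param_mult[OF word[of u] \<rho>[OF c]] acts_on_param_mult[OF word[of v] \<rho>[OF d]]
      unfolding eq by (rule acts_on_param_unique)
    \<comment> \<open>The constants are \<open>c\<close> and \<open>d\<close> up to sign plus even
      numbers, so parity yields \<open>c = d\<close>; then the signs agree, and finally the
      translations.\<close>
    then have "c = d \<and> fst (word_act u) = fst (word_act v) \<and> snd (word_act u) = snd (word_act v)"
      using c d word_act_fst[of u] word_act_fst[of v] by (elim disjE insertE emptyE; simp; presburger)
    then show ?thesis by (simp add: word_eq_iff_word_act prod_eq_iff)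
  qed
  have "\<exists>\<Phi> \<in> iso C2_ltimes_affine_weyl_A1 (subgroup_generated ?G {?s, ?r}).
      \<Phi> (0, word_class [S0]) = ?r \<otimes>\<^bsub>?G\<^esub> ?s \<otimes>\<^bsub>?G\<^esub> inv\<^bsub>?G\<^esub> ?r \<and>
      \<Phi> (0, word_class [S1]) = ?s \<and> \<Phi> (1, word_class []) = ?r"
    by (rule iso_C2_ltimes_affine_weyl_A1[OF s r faithful])
  then show ?thesis
    unfolding Let_def by (intro conjI baecklund_s1 baecklund_r birational_s1 birational_r)
qed

end
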